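(* Let $\mathcal{X}$ be a real separable Hilbert space and let $X$ be an $R$-subgaussian random vector in $\mathcal{X}$, where $R:\mathcal{X}\to\mathcal{X}$ is a positive self-adjoint trace class operator. Then $$\log \mathbb{E}\left[ e^{\lambda \|X\|_{\mathcal{X}}^2} \right] \leq \lambda \operatorname{tr}(R) + \frac{\lambda^2 \|R\|_{S_2(\mathcal{X})}^2}{1 - 2\lambda \|R\|}\quad\text{for all } \lambda \geq 0 \text{ with } 2\lambda\|R\| < 1.$$ In particular, $$\mathbb{P}\left[ \|X\|_{\mathcal{X}}^2 > \operatorname{tr}(R) + 2\sqrt{t}\, \|R\|_{S_2(\mathcal{X})} + 2t \|R\| \right] \leq e^{-t}\quad\text{for all } t \geq 0.$$
   Context: Random vectors in $\mathcal{X}$ are measurable functions (in the Bochner sense) from a probability space $(\Omega,\mathcal{F},\mathbb{P})$ to $\mathcal{X}$ with its Borel $\sigma$-field. Let $R:\mathcal{X}\to\mathcal{X}$ be a positive self-adjoint trace class operator (positive means $\langle u, Ru\rangle_{\mathcal{X}}\ge 0$ for all $u$). An integrable centered ($\mathbb{E}[X]=0$) random vector $X$ in $\mathcal{X}$ is called $R$-subgaussian if $\log \mathbb{E}[e^{\langle u, X\rangle_{\mathcal{X}}}] \leq \frac{1}{2}\langle u, Ru\rangle_{\mathcal{X}}$ for all $u \in \mathcal{X}$. Here $\|R\|$ denotes the operator norm, $\|R\|_{S_2(\mathcal{X})}$ the Hilbert--Schmidt norm, and $\operatorname{tr}$ the trace. *)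

theory Defs
  imports "HOL-Probability.Probability"
begin

definition orthonormal_basis :: "'a::real_inner set \<Rightarrow> bool" where
  "orthonormal_basis B \<longleftrightarrow>
     pairwise orthogonal B \<and> (\<forall>e\<in>B. norm e = 1) \<and> closure (span B) = UNIV"

text \<open>Gram--Schmidt along a countable dense set, so that the choice of a basis in the
  definition of \<open>some_onb\<close> below is justified.\<close>

lemma orthonormal_extend:
  fixes C :: "'a::real_inner set"
  assumes "finite C" "pairwise orthogonal C" "\<forall>e\<in>C. norm e = 1"
  shows "\<exists>C'. finite C' \<and> pairwise orthogonal C' \<and> (\<forall>e\<in>C'. norm e = 1) \<and> C \<subseteq> C' \<and> d \<in> span C'"
proof -
  define p where "p = (\<Sum>c\<in>C. (c \<bullet> d) *\<^sub>R c)"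
  define v where "v = d - p"
  have pC: "p \<in> span C"
    unfolding p_def by (intro span_sum span_scale span_base)
  have orth: "c \<bullet> v = 0" if "c \<in> C" for c
  proof -
    have "c \<bullet> p = (\<Sum>x\<in>C. (x \<bullet> d) * (c \<bullet> x))"
      by (simp add: p_def inner_sum_right)
    also have "\<dots> = (\<Sum>x\<in>C. if x = c then c \<bullet> d else 0)"
    proof (rule sum.cong)
      fix x assume "x \<in> C"
      have "c \<bullet> c = 1" using assms(3) that by (simp add: dot_square_norm)
      moreover have "x \<noteq> c \<Longrightarrow> c \<bullet> x = 0"
        using assms(2) that \<open>x \<in> C\<close> unfolding pairwise_def orthogonal_def by metis
      ultimately show "(x \<bullet> d) * (c \<bullet> x) = (if x = c then c \<bullet> d else 0)" by auto
    qed simp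
    also have "\<dots> = c \<bullet> d" using assms(1) that by simp
    finally show ?thesis by (simp add: v_def inner_diff_right)
  qed
  show ?thesis
  proof (cases "v = 0")
    case True
    then have "d \<in> span C" using pC by (simp add: v_def)
    then show ?thesis using assms by blast
  next
    case False
    define u where "u = v /\<^sub>R norm v"
    have nu: "norm u = 1" using False by (simp add: u_def)
    have ou: "orthogonal u c" "orthogonal c u" if "c \<in> C" for c
      using orth[OF that] by (simp_all add: orthogonal_def u_def inner_commute)
    have "d = norm v *\<^sub>R u + p" using False by (simp add: u_def v_def)
    moreover have "norm v *\<^sub>R u + p \<in> span (insert u C)"
      using pC span_mono[of C "insert u C"]
      by (intro span_add span_scale) (auto intro: span_base)
    ultimately have "d \<in> span (insert u C)" by simp
    moreover have "pairwise orthogonal (insert u C)"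
      using assms(2) ou by (auto simp: pairwise_insert)
    ultimately show ?thesis
      using assms nu by (intro exI[of _ "insert u C"]) auto
  qed
qed

lemma orthonormal_basis_exists:
  "\<exists>B :: 'a::{real_inner, second_countable_topology} set. orthonormal_basis B"
proof -
  obtain D :: "'a set" where D: "countable D" "\<And>X. open X \<Longrightarrow> X \<noteq> {} \<Longrightarrow> \<exists>d\<in>D. d \<in> X"
    using countable_dense_setE by metis
  have ne: "D \<noteq> {}" using D(2)[of UNIV] by auto
  let ?P = "\<lambda>C :: 'a set. finite C \<and> pairwise orthogonal C \<and> (\<forall>e\<in>C. norm e = 1)"
  have "\<exists>f. \<forall>n. ?P (f n) \<and> (f n \<subseteq> f (Suc n) \<and> from_nat_into D n \<in> span (f (Suc n)))"
  proof (rule dependent_nat_choice)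
    show "\<exists>C. ?P C" by (intro exI[of _ "{}"]) auto
    show "\<exists>C'. ?P C' \<and> (C \<subseteq> C' \<and> from_nat_into D n \<in> span C')" if "?P C" for C n
      using orthonormal_extend[of C "from_nat_into D n"] that by blast
  qed
  then obtain f where f: "\<And>n. ?P (f n)" "\<And>n. f n \<subseteq> f (Suc n)"
    "\<And>n. from_nat_into D n \<in> span (f (Suc n))" by blast
  have mono: "f m \<subseteq> f n" if "m \<le> n" for m n
    using f(2) that by (rule lift_Suc_mono_le)
  define B where "B = (\<Union>n. f n)"
  have "pairwise orthogonal B"
    unfolding pairwise_def
  proof (intro ballI impI)
    fix x y assume "x \<in> B" "y \<in> B" "x \<noteq> y"
    then obtain m n where "x \<in> f m" "y \<in> f n" by (auto simp: B_def)
    then have "x \<in> f (max m n)" "y \<in> f (max m n)"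
      using mono[of m "max m n"] mono[of n "max m n"] by auto
    then show "orthogonal x y"
      using f(1)[of "max m n"] \<open>x \<noteq> y\<close> unfolding pairwise_def by blast
  qed
  moreover have "\<forall>e\<in>B. norm e = 1" using f(1) by (auto simp: B_def)
  moreover have "closure (span B) = UNIV"
  proof -
    have DB: "D \<subseteq> span B"
    proof
      fix d assume "d \<in> D"
      then obtain n where "d = from_nat_into D n"
        using from_nat_into_surj[OF D(1)] by metis
      moreover have "span (f (Suc n)) \<subseteq> span B"
        by (rule span_mono) (auto simp: B_def)
      ultimately show "d \<in> span B" using f(3) by auto
    qed
    have "x \<in> closure D" for x
      unfolding closure_approachable
    proof (intro allI impI)
      fix e :: real assume "e > 0"
      then show "\<exists>y\<in>D. dist y x < e"
        using D(2)[of "ball x e"] by (auto simp: dist_commute)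
    qed
    then show ?thesis using closure_mono[OF DB] by auto
  qed
  ultimately show ?thesis unfolding orthonormal_basis_def by blast
qed

definition some_onb :: "'a::real_inner set" where
  "some_onb = (SOME B. orthonormal_basis B)"

definition self_adjoint_op :: "('a::real_inner \<Rightarrow> 'a) \<Rightarrow> bool" where
  "self_adjoint_op T \<longleftrightarrow> (\<forall>x y. T x \<bullet> y = x \<bullet> T y)"

definition positive_op :: "('a::real_inner \<Rightarrow> 'a) \<Rightarrow> bool" where
  "positive_op T \<longleftrightarrow> (\<forall>u. 0 \<le> u \<bullet> T u)"

text \<open>\<open>T\<close> is trace class if the sum of \<open>\<langle>e, |T| e\<rangle>\<close> over some (equivalently, every)
  orthonormal basis is finite. The operator \<open>A\<close> below is \<open>|T|\<close>, the unique positive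
  square root of \<open>T\<^sup>* T\<close>.\<close>

definition trace_class :: "('a::real_inner \<Rightarrow> 'a) \<Rightarrow> bool" where
  "trace_class T \<longleftrightarrow> bounded_linear T \<and>
     (\<exists>A. bounded_linear A \<and> self_adjoint_op A \<and> positive_op A \<and> A \<circ> A = adjoint T \<circ> T \<and>
        (\<exists>B. orthonormal_basis B \<and> (\<lambda>e. e \<bullet> A e) summable_on B))"

text \<open>The two sums below do not depend on the basis. They are only meaningful when they
  converge, which they do for trace class operators (\<open>infsum\<close> is \<open>0\<close> otherwise).\<close>

definition op_trace :: "('a::real_inner \<Rightarrow> 'a) \<Rightarrow> real" where
  "op_trace T = (\<Sum>\<^sub>\<infinity>e\<in>some_onb. e \<bullet> T e)"

definition hs_norm :: "('a::real_inner \<Rightarrow> 'a) \<Rightarrow> real" where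
  "hs_norm T = sqrt (\<Sum>\<^sub>\<infinity>e\<in>some_onb. (norm (T e))\<^sup>2)"

text \<open>Since the integral of a non-integrable function is \<open>0\<close> and \<open>ln 0 = 0\<close>, a bound on the
  logarithm of an exponential moment has to state that the moment is finite. In a
  second-countable space, Bochner measurability is Borel measurability, which is part of
  \<open>integrable\<close>.\<close>

definition log_moment_le :: "'b measure \<Rightarrow> ('b \<Rightarrow> real) \<Rightarrow> real \<Rightarrow> bool" where
  "log_moment_le M Y c \<longleftrightarrow>
     integrable M (\<lambda>\<omega>. exp (Y \<omega>)) \<and> ln (\<integral>\<omega>. exp (Y \<omega>) \<partial>M) \<le> c"

definition subgaussian ::
  "'b measure \<Rightarrow> ('a::{real_inner, banach, second_countable_topology} \<Rightarrow> 'a) \<Rightarrow> ('b \<Rightarrow> 'a) \<Rightarrow> bool" where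
  "subgaussian M R X \<longleftrightarrow>
     integrable M X \<and> (\<integral>\<omega>. X \<omega> \<partial>M) = 0 \<and>
     (\<forall>u. log_moment_le M (\<lambda>\<omega>. u \<bullet> X \<omega>) (1 / 2 * (u \<bullet> R u)))"

end

theory Submission
  imports Defs
begin

text \<open>If \<open>g\<close> is a standard Gaussian vector in a finite-dimensional subspace, independent of \<open>X\<close>,
  then \<open>exp (\<lambda> \<parallel>P X\<parallel>\<^sup>2) = E\<^sub>g exp (\<surd>(2\<lambda>) \<langle>g, X\<rangle>)\<close> for the orthogonal projection \<open>P\<close> onto the subspace.
  Exchanging the expectations and using the subgaussian hypothesis leaves
  \<open>E\<^sub>g exp (\<lambda> \<langle>g, R g\<rangle>) = \<Prod>\<^sub>i (1 - 2 \<lambda> \<mu>\<^sub>i)\<^sup>-\<^sup>1\<^sup>/\<^sup>2\<close>, where \<open>\<mu>\<^sub>i\<close> are the eigenvalues of the compression of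
  \<open>R\<close>, and \<open>(1 - 2 x)\<^sup>-\<^sup>1\<^sup>/\<^sup>2 \<le> exp (x + x\<^sup>2 / (1 - 2 x))\<close> gives the bound for \<open>P X\<close>. Fatou's lemma along an
  orthonormal basis then gives the bound for \<open>X\<close>, and Chernoff's method the tail estimate.\<close>

section \<open>Orthonormal sets and spectral bases\<close>

definition orthonormal :: "'a::real_inner set \<Rightarrow> bool" where
  "orthonormal E \<longleftrightarrow> pairwise orthogonal E \<and> (\<forall>e\<in>E. norm e = 1)"

lemma orthonormalI:
  assumes "\<And>e. e \<in> E \<Longrightarrow> norm e = 1"
    and "\<And>e f. e \<in> E \<Longrightarrow> f \<in> E \<Longrightarrow> e \<noteq> f \<Longrightarrow> e \<bullet> f = 0"
  shows "orthonormal E"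
  using assms by (auto simp: orthonormal_def pairwise_def orthogonal_def)

lemma orthonormal_inner:
  assumes "orthonormal E" "e \<in> E" "f \<in> E"
  shows "e \<bullet> f = (if e = f then 1 else 0)"
  using assms by (auto simp: orthonormal_def pairwise_def orthogonal_def dot_square_norm)

lemma orthonormal_norm: "orthonormal E \<Longrightarrow> e \<in> E \<Longrightarrow> norm e = 1"
  by (simp add: orthonormal_def)

lemma orthonormal_subset: "orthonormal E \<Longrightarrow> F \<subseteq> E \<Longrightarrow> orthonormal F"
  by (auto simp: orthonormal_def intro: pairwise_mono)

text \<open>For finite orthonormal \<open>E\<close> this is the orthogonal projection onto
  \<open>span E\<close>, written as a sum so that it makes sense in any inner product space. For
  infinite \<open>E\<close> the sum defaults to 0.\<close>

definition proj :: "'a::real_inner set \<Rightarrow> 'a \<Rightarrow> 'a" where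
  "proj E x = (\<Sum>e\<in>E. (e \<bullet> x) *\<^sub>R e)"

lemma proj_in_span: "proj E x \<in> span E"
  unfolding proj_def by (intro span_sum span_scale span_base)

text \<open>Checked on \<open>E\<close> by orthonormality and extended linearly: this is the
  orthogonality of \<open>x - proj E x\<close> to the span.\<close>

lemma inner_proj:
  assumes "finite E" "orthonormal E" "y \<in> span E"
  shows "y \<bullet> proj E x = y \<bullet> x"
proof -
  have base: "e \<bullet> proj E x = e \<bullet> x" if "e \<in> E" for e
  proof -
    have "e \<bullet> proj E x = (\<Sum>f\<in>E. if f = e then e \<bullet> x else 0)"
      unfolding proj_def inner_sum_right
      by (rule sum.cong) (auto simp: orthonormal_inner[OF assms(2) that])
    then show ?thesis using assms(1) that by simp
  qed
  show ?thesis
    using assms(3) by (induction rule: span_induct_alt) (simp_all add: base inner_add_left)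
qed

lemma proj_span:
  assumes "finite E" "orthonormal E" "y \<in> span E"
  shows "proj E y = y"
proof -
  have "y - proj E y \<in> span E" by (intro span_diff assms proj_in_span)
  from inner_proj[OF assms(1,2) this, of y]
  have "(y - proj E y) \<bullet> (y - proj E y) = 0"
    by (simp add: inner_diff_right)
  then show ?thesis by simp
qed

lemma inner_proj_self: "finite E \<Longrightarrow> x \<bullet> proj E y = (\<Sum>e\<in>E. (e \<bullet> x) * (e \<bullet> y))"
  unfolding proj_def inner_sum_right by (simp add: inner_commute mult.commute)

lemma norm_proj:
  assumes "finite E" "orthonormal E"
  shows "(norm (proj E x))\<^sup>2 = (\<Sum>e\<in>E. (e \<bullet> x)\<^sup>2)"
proof -
  have "(norm (proj E x))\<^sup>2 = proj E x \<bullet> proj E x" by (simp add: power2_norm_eq_inner)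
  also have "\<dots> = x \<bullet> proj E x"
    using inner_proj[OF assms proj_in_span, of x x] by (simp add: inner_commute)
  finally show ?thesis using assms by (simp add: inner_proj_self power2_eq_square)
qed

text \<open>\<open>proj E x - y\<close> lies in the span, hence is orthogonal to
  \<open>x - proj E x\<close>, and Pythagoras applies. This best approximation later gives the
  convergence of projections along a basis.\<close>

lemma norm_diff_proj:
  assumes "finite E" "orthonormal E" "y \<in> span E"
  shows "norm (x - proj E x) \<le> norm (x - y)"
proof -
  define z where "z = proj E x - y"
  have "z \<in> span E" unfolding z_def by (intro span_diff assms proj_in_span)
  then have "z \<bullet> (x - proj E x) = 0"
    using inner_proj[OF assms(1,2)] by (simp add: inner_diff_right)
  moreover have "x - y = (x - proj E x) + z" by (simp add: z_def)
  ultimately have "(norm (x - y))\<^sup>2 = (norm (x - proj E x))\<^sup>2 + (norm z)\<^sup>2"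
    by (metis inner_commute norm_add_Pythagorean orthogonal_def)
  then have "(norm (x - proj E x))\<^sup>2 \<le> (norm (x - y))\<^sup>2" by simp
  then show ?thesis by (rule power2_le_imp_le) simp
qed

lemma bessel:
  assumes "finite E" "orthonormal E"
  shows "(\<Sum>e\<in>E. (e \<bullet> x)\<^sup>2) \<le> (norm x)\<^sup>2"
proof -
  have "(norm (proj E x))\<^sup>2 = x \<bullet> proj E x"
    using norm_proj[OF assms, of x] by (simp add: inner_proj_self[OF assms(1)] power2_eq_square)
  also have "\<dots> \<le> norm x * norm (proj E x)" by (rule norm_cauchy_schwarz)
  finally have "norm (proj E x) \<le> norm x"
    by (cases "norm (proj E x) = 0") (simp_all add: power2_eq_square)
  then show ?thesis using norm_proj[OF assms, of x] by (metis norm_ge_zero power_mono)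
qed

text \<open>The difference of the two projections lies in the common span and has the same inner
  product with both, so it is orthogonal to itself and vanishes. Both sums are the squared norm of
  the one projection.\<close>

lemma parseval_span_eq:
  assumes "finite E" "orthonormal E" "finite F" "orthonormal F" "span E = span F"
  shows "(\<Sum>e\<in>E. (e \<bullet> x)\<^sup>2) = (\<Sum>f\<in>F. (f \<bullet> x)\<^sup>2)"
proof -
  have "norm (proj E x - proj F x) ^ 2 =
      (proj E x - proj F x) \<bullet> proj E x - (proj E x - proj F x) \<bullet> proj F x"
    by (simp add: power2_norm_eq_inner inner_diff_right)
  also have "proj E x - proj F x \<in> span E"
    using proj_in_span[of E x] proj_in_span[of F x] assms(5) by (auto intro: span_diff)
  then have "(proj E x - proj F x) \<bullet> proj E x - (proj E x - proj F x) \<bullet> proj F x = 0"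
    using assms by (simp add: inner_proj)
  finally have "proj E x = proj F x" by simp
  then show ?thesis using assms norm_proj by metis
qed

text \<open>Expand each \<open>f\<close> in \<open>E\<close>, swap the sums and collect
  \<open>proj F e = e\<close>: the trace of a compression depends on the subspace only.\<close>

lemma trace_span_eq:
  fixes T :: "'a::real_inner \<Rightarrow> 'a"
  assumes "finite E" "orthonormal E" "finite F" "orthonormal F" "span E = span F" "linear T"
  shows "(\<Sum>e\<in>E. e \<bullet> T e) = (\<Sum>f\<in>F. f \<bullet> T f)"
proof -
  have "(\<Sum>f\<in>F. f \<bullet> T f) = (\<Sum>f\<in>F. f \<bullet> T (proj E f))"
    using assms by (intro sum.cong) (auto simp: proj_span span_base)
  also have "\<dots> = (\<Sum>f\<in>F. \<Sum>e\<in>E. (e \<bullet> f) * (f \<bullet> T e))"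
    using assms(6) by (simp add: proj_def linear_sum linear_scale inner_sum_right)
  also have "\<dots> = (\<Sum>e\<in>E. \<Sum>f\<in>F. (e \<bullet> f) * (f \<bullet> T e))" by (rule sum.swap)
  also have "\<dots> = (\<Sum>e\<in>E. proj F e \<bullet> T e)"
    by (intro sum.cong refl) (simp add: proj_def inner_sum_left, simp add: inner_commute)
  also have "\<dots> = (\<Sum>e\<in>E. e \<bullet> T e)"
    using assms(3-5) by (intro sum.cong refl) (metis proj_span span_base)
  finally show ?thesis by simp
qed

section \<open>Diagonalising the compression of a self-adjoint operator to a finite-dimensional
  span\<close>

text \<open>First-order condition at a maximum: near \<open>t = 0\<close> a nonzero linear term
  would dominate. It is applied to variations of a Rayleigh quotient.\<close>

lemma quadratic_nonpos_imp_zero: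
  fixes b c :: real
  assumes "\<And>t. 2 * t * b + t\<^sup>2 * c \<le> 0"
  shows "b = 0"
proof (rule ccontr)
  assume "b \<noteq> 0"
  \<comment> \<open>The test point is \<open>t = b / k\<close>; taking \<open>k > |c|\<close> makes
    \<open>2 * k + c\<close> positive, hence also the quadratic at \<open>t\<close>.\<close>
  define k where "k = \<bar>c\<bar> + 1"
  have k: "k > 0" "2 * k + c > 0" by (auto simp: k_def)
  have "2 * (b / k) * b + (b / k)\<^sup>2 * c = (b / k)\<^sup>2 * (2 * k + c)"
    using k by (simp add: field_simps power2_eq_square)
  also have "\<dots> > 0" using k \<open>b \<noteq> 0\<close> by simp
  finally show False using assms[of "b / k"] by simp
qed

text \<open>Provides compactness inside a possibly infinite-dimensional space: adding a vector
  \<open>e\<close> makes the box the image of an interval times the smaller box under the continuous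
  map \<open>(t, y) \<mapsto> t e + y\<close>.\<close>

lemma compact_coordinate_box:
  fixes E :: "'a::real_normed_vector set"
  assumes "finite E"
  shows "compact {(\<Sum>e\<in>E. a e *\<^sub>R e) | a. \<forall>e\<in>E. \<bar>a e\<bar> \<le> 1}"
  using assms
proof induction
  case empty
  then show ?case by simp
next
  case (insert e E)
  let ?K = "\<lambda>E. {(\<Sum>e\<in>E. a e *\<^sub>R e) | a. \<forall>e\<in>E. \<bar>a e\<bar> \<le> (1::real)}"
  have "?K (insert e E) = (\<lambda>(t, y). t *\<^sub>R e + y) ` ({-1..1} \<times> ?K E)"
  proof (intro equalityI subsetI)
    fix x assume "x \<in> ?K (insert e E)"
    then obtain a where "x = (\<Sum>e\<in>insert e E. a e *\<^sub>R e)" "\<forall>e\<in>insert e E. \<bar>a e\<bar> \<le> 1" by blast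
    then show "x \<in> (\<lambda>(t, y). t *\<^sub>R e + y) ` ({-1..1} \<times> ?K E)"
      using insert by (intro image_eqI[of _ _ "(a e, \<Sum>e\<in>E. a e *\<^sub>R e)"]) auto
  next
    fix x assume "x \<in> (\<lambda>(t, y). t *\<^sub>R e + y) ` ({-1..1} \<times> ?K E)"
    then obtain t a where ta: "x = t *\<^sub>R e + (\<Sum>e\<in>E. a e *\<^sub>R e)" "\<forall>e\<in>E. \<bar>a e\<bar> \<le> 1" "\<bar>t\<bar> \<le> 1"
      by auto
    have "(\<Sum>e\<in>E. a e *\<^sub>R e) = (\<Sum>f\<in>E. (a(e := t)) f *\<^sub>R f)"
      using insert by (intro sum.cong) auto
    then have "x = (\<Sum>f\<in>insert e E. (a(e := t)) f *\<^sub>R f)"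
      using insert ta(1) by simp
    moreover have "\<forall>f\<in>insert e E. \<bar>(a(e := t)) f\<bar> \<le> 1" using ta by auto
    ultimately show "x \<in> ?K (insert e E)" by blast
  qed
  moreover have "compact ((\<lambda>(t, y). t *\<^sub>R e + y) ` ({-1..1::real} \<times> ?K E))"
    using insert.IH
    by (intro compact_continuous_image compact_Times)
       (auto intro!: continuous_intros simp: case_prod_unfold)
  ultimately show ?case by simp
qed

text \<open>A maximiser of \<open>x \<bullet> R x\<close> on the unit sphere of \<open>V\<close>,
  the part of \<open>span E\<close> orthogonal to \<open>F\<close>, is an eigenvector of the
  compression of \<open>R\<close> to \<open>V\<close>. The last conclusion says this without an
  eigenvalue: \<open>R f\<close> is orthogonal to every vector of \<open>V\<close> that is
  orthogonal to \<open>f\<close>.\<close>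

lemma rayleigh_maximiser:
  fixes R :: "'a::real_inner \<Rightarrow> 'a"
  assumes E: "finite E" "orthonormal E" and R: "bounded_linear R" "self_adjoint_op R"
    and w: "w \<in> span E" "w \<noteq> 0" "\<And>c. c \<in> F \<Longrightarrow> c \<bullet> w = 0"
  obtains f where "f \<in> span E" "norm f = 1" "\<And>c. c \<in> F \<Longrightarrow> c \<bullet> f = 0"
    "\<And>z. z \<in> span E \<Longrightarrow> (\<And>c. c \<in> F \<Longrightarrow> c \<bullet> z = 0) \<Longrightarrow> f \<bullet> z = 0 \<Longrightarrow> z \<bullet> R f = 0"
proof -
  interpret R: bounded_linear R by fact
  define V where "V = {y \<in> span E. \<forall>c\<in>F. c \<bullet> y = 0}"
  define K where "K = {(\<Sum>e\<in>E. a e *\<^sub>R e) | a. \<forall>e\<in>E. \<bar>a e\<bar> \<le> (1::real)}"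
  \<comment> \<open>\<open>C\<close> is the unit sphere of \<open>V\<close>, cut out of the compact
    box by closed conditions; a unit vector has coordinates of modulus at most 1.\<close>
  define C where "C = K \<inter> {y. norm y = 1 \<and> (\<forall>c\<in>F. c \<bullet> y = 0)}"
  have "C = K \<inter> ({y. norm y = 1} \<inter> (\<Inter>c\<in>F. {y. c \<bullet> y = 0}))"
    by (auto simp: C_def)
  moreover have "closed ({y::'a. norm y = 1} \<inter> (\<Inter>c\<in>F. {y. c \<bullet> y = 0}))"
    by (intro closed_Int closed_INT ballI closed_Collect_eq continuous_intros)
  ultimately have compC: "compact C"
    using compact_coordinate_box[OF E(1)] by (simp add: K_def compact_Int_closed)
  have C: "y \<in> C \<longleftrightarrow> y \<in> V \<and> norm y = 1" for y
  proof
    assume "y \<in> C"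
    then show "y \<in> V \<and> norm y = 1"
      by (auto simp: C_def K_def V_def intro!: span_sum span_scale intro: span_base)
  next
    assume y: "y \<in> V \<and> norm y = 1"
    have "y = (\<Sum>e\<in>E. (e \<bullet> y) *\<^sub>R e)"
      using proj_span[OF E, of y] y by (simp add: V_def proj_def)
    moreover have "\<bar>e \<bullet> y\<bar> \<le> 1" if "e \<in> E" for e
      using Cauchy_Schwarz_ineq2[of e y] y orthonormal_norm[OF E(2) that] by simp
    ultimately have "y \<in> K" unfolding K_def by (intro CollectI exI[of _ "\<lambda>e. e \<bullet> y"]) auto
    then show "y \<in> C" using y by (simp add: C_def V_def)
  qed
  have Vlin: "x + t *\<^sub>R y \<in> V" "t *\<^sub>R y \<in> V" if "x \<in> V" "y \<in> V" for x y t
    using that by (auto simp: V_def inner_add_right intro: span_add span_scale)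
  have "(1 / norm w) *\<^sub>R w \<in> C"
    using w by (auto simp: C V_def intro: span_scale)
  then have "C \<noteq> {}" by blast
  moreover have "continuous_on C (\<lambda>x. x \<bullet> R x)"
    by (intro continuous_intros R.continuous_on)
  ultimately obtain f where f: "f \<in> C" and max: "\<And>y. y \<in> C \<Longrightarrow> y \<bullet> R y \<le> f \<bullet> R f"
    using continuous_attains_sup[OF compC, of "\<lambda>x. x \<bullet> R x"] by auto
  \<comment> \<open>Homogeneity extends the bound to all of \<open>V\<close>, so the perturbation
    \<open>f + t z\<close> need not be normalised.\<close>
  have max': "y \<bullet> R y \<le> (f \<bullet> R f) * (norm y)\<^sup>2" if "y \<in> V" for y
  proof (cases "y = 0")
    case True
    then show ?thesis by (simp add: R.zero)
  next
    case False
    have "(1 / norm y) *\<^sub>R y \<in> C" using that False Vlin by (auto simp: C)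
    from max[OF this] show ?thesis
      using False by (simp add: R.scaleR field_simps power2_eq_square)
  qed
  have "z \<bullet> R f = 0" if z: "z \<in> span E" "\<And>c. c \<in> F \<Longrightarrow> c \<bullet> z = 0" "f \<bullet> z = 0" for z
  proof (rule quadratic_nonpos_imp_zero)
    fix t :: real
    have zV: "z \<in> V" using z by (simp add: V_def)
    have fV: "f \<in> V" "norm f = 1" using f C by auto
    have sym: "f \<bullet> R z = z \<bullet> R f"
      using R(2) unfolding self_adjoint_op_def by (metis inner_commute)
    have "(norm (f + t *\<^sub>R z))\<^sup>2 = 1 + t\<^sup>2 * (norm z)\<^sup>2"
      using z(3) fV(2) norm_add_Pythagorean[of f "t *\<^sub>R z"]
      by (simp add: orthogonal_def power_mult_distrib)
    then have "(f + t *\<^sub>R z) \<bullet> R (f + t *\<^sub>R z) \<le> (f \<bullet> R f) * (1 + t\<^sup>2 * (norm z)\<^sup>2)"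
      using max'[OF Vlin(1)[OF fV(1) zV]] by metis
    then show "2 * t * (z \<bullet> R f) + t\<^sup>2 * (z \<bullet> R z - (f \<bullet> R f) * (norm z)\<^sup>2) \<le> 0"
      using sym by (simp add: R.add R.scaleR inner_add_left inner_add_right algebra_simps
          power2_eq_square)
  qed
  then show ?thesis using f C that V_def by blast
qed

lemma span_orthogonal_complement:
  assumes "finite F" "orthonormal F" "F \<subseteq> span E" "x \<in> span E"
  shows "x - proj F x \<in> span E" "\<And>c. c \<in> F \<Longrightarrow> c \<bullet> (x - proj F x) = 0"
proof -
  have "span F \<subseteq> span E" using assms(3) by (simp add: span_minimal)
  then show "x - proj F x \<in> span E"
    using proj_in_span[of F x] assms(4) by (auto intro: span_diff)
  show "c \<bullet> (x - proj F x) = 0" if "c \<in> F" for c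
    using inner_proj[OF assms(1,2) span_base[OF that]] by (simp add: inner_diff_right)
qed

text \<open>A largest orthonormal set of eigenvectors of the compression to \<open>span E\<close>
  must span: otherwise a Rayleigh maximiser on its orthogonal complement would enlarge it.\<close>

lemma finite_spectral_basis:
  fixes R :: "'a::real_inner \<Rightarrow> 'a"
  assumes E: "finite E" "orthonormal E" and R: "bounded_linear R" "self_adjoint_op R"
  obtains F where "finite F" "orthonormal F" "span F = span E"
    "\<And>f g. f \<in> F \<Longrightarrow> g \<in> F \<Longrightarrow> f \<noteq> g \<Longrightarrow> f \<bullet> R g = 0"
proof -
  interpret R: bounded_linear R by fact
  \<comment> \<open>The quantified clause says that each \<open>f\<close> is an eigenvector of the
    compression of \<open>R\<close> to the whole of \<open>span E\<close>.\<close>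
  define P where "P F \<longleftrightarrow> finite F \<and> orthonormal F \<and> F \<subseteq> span E \<and>
    (\<forall>f\<in>F. \<forall>y\<in>span E. f \<bullet> y = 0 \<longrightarrow> y \<bullet> R f = 0)" for F
  have "P {}" by (simp add: P_def orthonormal_def)
  moreover have "card F \<le> card E" if "P F" for F
  proof -
    have "independent F"
      using that unfolding P_def orthonormal_def
      by (intro pairwise_orthogonal_independent) auto
    then show ?thesis using independent_span_bound[OF E(1)] that by (auto simp: P_def)
  qed
  ultimately obtain F where F: "P F" and max: "\<And>G. P G \<Longrightarrow> card G \<le> card F"
    using ex_has_greatest_nat[of P "{}" card "Suc (card E)"] by (metis le_imp_less_Suc)
  have PF: "finite F" "orthonormal F" "F \<subseteq> span E"
    "\<And>f y. f \<in> F \<Longrightarrow> y \<in> span E \<Longrightarrow> f \<bullet> y = 0 \<Longrightarrow> y \<bullet> R f = 0"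
    using F by (auto simp: P_def)
  have "span E \<subseteq> span F"
  proof (rule ccontr)
    assume "\<not> span E \<subseteq> span F"
    then obtain x where x: "x \<in> span E" "x \<notin> span F" by blast
    have "x - proj F x \<noteq> 0" using x proj_in_span[of F x] by auto
    then obtain f where f: "f \<in> span E" "norm f = 1" "\<And>c. c \<in> F \<Longrightarrow> c \<bullet> f = 0"
      "\<And>z. z \<in> span E \<Longrightarrow> (\<And>c. c \<in> F \<Longrightarrow> c \<bullet> z = 0) \<Longrightarrow> f \<bullet> z = 0 \<Longrightarrow> z \<bullet> R f = 0"
      using rayleigh_maximiser[OF E R, of "x - proj F x" F]
        span_orthogonal_complement[OF PF(1-3) x(1)] by metis
    have "f \<notin> F"
    proof
      assume "f \<in> F"
      from f(3)[OF this] f(2) show False by simp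
    qed
    moreover have "P (insert f F)"
    proof -
      \<comment> \<open>So far \<open>f\<close> is an eigenvector only on the complement of
        \<open>F\<close>. The component of \<open>y\<close> along \<open>F\<close> is handled by
        symmetry: each \<open>c\<close> in \<open>F\<close> is an eigenvector orthogonal to
        \<open>f\<close>, so \<open>c \<bullet> R f = 0\<close>.\<close>
      have "y \<bullet> R f = 0" if y: "y \<in> span E" "f \<bullet> y = 0" for y
      proof -
        have "c \<bullet> R f = 0" if "c \<in> F" for c
          using PF(4)[OF that f(1) f(3)[OF that]] R(2)
          unfolding self_adjoint_op_def by (metis inner_commute)
        then have 1: "proj F y \<bullet> R f = 0" by (simp add: proj_def inner_sum_left)
        have "f \<bullet> proj F y = 0" using f(3) PF(1) by (simp add: inner_proj_self)
        then have "(y - proj F y) \<bullet> R f = 0"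
          using y span_orthogonal_complement[OF PF(1-3) y(1)]
          by (intro f(4)) (auto simp: inner_diff_right)
        then show ?thesis using 1 by (simp add: inner_diff_left)
      qed
      moreover have "orthonormal (insert f F)"
        using f PF(2) by (intro orthonormalI) (auto simp: orthonormal_inner orthonormal_norm inner_commute)
      ultimately show ?thesis using PF f(1) by (auto simp: P_def)
    qed
    ultimately show False using max[of "insert f F"] PF(1) by simp
  qed
  moreover have "span F \<subseteq> span E" using PF(3) by (simp add: span_minimal)
  moreover have "f \<bullet> R g = 0" if "f \<in> F" "g \<in> F" "f \<noteq> g" for f g
    using that PF by (intro PF(4)) (auto simp: orthonormal_inner)
  ultimately show ?thesis using that[of F] PF by blast
qed

section \<open>Positive operators and traces\<close>

lemma onorm_norm_le: "bounded_linear T \<Longrightarrow> norm x \<le> 1 \<Longrightarrow> norm (T x) \<le> onorm T"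
  using onorm[of T x] mult_left_mono[of "norm x" 1 "onorm T"] onorm_pos_le[of T] by simp

lemma inner_le_onorm: "bounded_linear T \<Longrightarrow> norm x = 1 \<Longrightarrow> x \<bullet> T x \<le> onorm T"
  using norm_cauchy_schwarz[of x "T x"] onorm_norm_le[of T x] by simp

lemma adjoint_self_adjoint_op: "self_adjoint_op T \<Longrightarrow> adjoint T = T"
  by (rule adjoint_unique) (simp add: self_adjoint_op_def)

section \<open>Cauchy-Schwarz for positive operators and uniqueness of the positive square
  root\<close>

text \<open>Evaluate at the minimiser \<open>t = - b / c\<close>. For \<open>c = 0\<close> and
  \<open>b \<noteq> 0\<close> the point \<open>t = - (a + 1) / (2 * b)\<close> would give the value
  -1.\<close>

lemma quadratic_nonneg_imp_discriminant:
  fixes a b c :: real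
  assumes "\<And>t. 0 \<le> a + 2 * t * b + t\<^sup>2 * c" "0 \<le> c"
  shows "b\<^sup>2 \<le> a * c"
proof (cases "c = 0")
  case True
  have "b = 0"
  proof (rule ccontr)
    assume "b \<noteq> 0"
    have "2 * (-(a + 1) / (2 * b)) * b = -(a + 1)" using \<open>b \<noteq> 0\<close> by simp
    then show False using assms(1)[of "-(a + 1) / (2 * b)"] True by simp
  qed
  then show ?thesis using True by simp
next
  case False
  then have c: "c > 0" using assms(2) by simp
  have "a + 2 * (- b / c) * b + (- b / c)\<^sup>2 * c = (a * c - b\<^sup>2) / c"
    using c by (simp add: field_simps power2_eq_square)
  then show ?thesis using assms(1)[of "- b / c"] c by (simp add: zero_le_divide_iff)
qed

text \<open>Cauchy-Schwarz for the semidefinite form of \<open>T\<close>, at \<open>x\<close> and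
  \<open>T x\<close>, bounds \<open>|T x|^4\<close> by \<open><x, T x> <T x, T (T x)>\<close>. The
  last factor is at most \<open>onorm T * |T x|^2\<close>, and \<open>|T x|^2\<close> cancels. With
  it, the trace sum dominates the Hilbert-Schmidt sum.\<close>

lemma norm_positive_op_le:
  fixes T :: "'a::real_inner \<Rightarrow> 'a"
  assumes T: "bounded_linear T" "self_adjoint_op T" "positive_op T"
  shows "(norm (T x))\<^sup>2 \<le> onorm T * (x \<bullet> T x)"
proof -
  interpret T: bounded_linear T by fact
  let ?y = "T x"
  have "(x \<bullet> T ?y)\<^sup>2 \<le> (x \<bullet> T x) * (?y \<bullet> T ?y)"
  proof (rule quadratic_nonneg_imp_discriminant)
    fix t :: real
    have "?y \<bullet> T x = x \<bullet> T ?y" using T(2) by (simp add: self_adjoint_op_def)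
    then have "x \<bullet> T x + 2 * t * (x \<bullet> T ?y) + t\<^sup>2 * (?y \<bullet> T ?y)
        = (x + t *\<^sub>R ?y) \<bullet> T (x + t *\<^sub>R ?y)"
      by (simp add: T.add T.scaleR inner_add_left inner_add_right algebra_simps power2_eq_square)
    then show "0 \<le> x \<bullet> T x + 2 * t * (x \<bullet> T ?y) + t\<^sup>2 * (?y \<bullet> T ?y)"
      using T(3) by (simp add: positive_op_def)
    show "0 \<le> ?y \<bullet> T ?y" using T(3) by (simp add: positive_op_def)
  qed
  moreover have "x \<bullet> T ?y = (norm ?y)\<^sup>2"
    using T(2) by (simp add: self_adjoint_op_def power2_norm_eq_inner)
  moreover have "?y \<bullet> T ?y \<le> onorm T * (norm ?y)\<^sup>2"
    using norm_cauchy_schwarz[of ?y "T ?y"] onorm[OF T(1), of ?y]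
      mult_left_mono[of "norm (T ?y)" "onorm T * norm ?y" "norm ?y"]
    by (simp add: power2_eq_square algebra_simps)
  moreover have "0 \<le> x \<bullet> T x" using T(3) by (simp add: positive_op_def)
  ultimately have "((norm ?y)\<^sup>2)\<^sup>2 \<le> (x \<bullet> T x) * (onorm T * (norm ?y)\<^sup>2)"
    by (metis mult_left_mono order_trans)
  then have "(norm ?y)\<^sup>2 * (norm ?y)\<^sup>2 \<le> (onorm T * (x \<bullet> T x)) * (norm ?y)\<^sup>2"
    by (simp add: power2_eq_square algebra_simps)
  moreover have "0 \<le> onorm T * (x \<bullet> T x)"
    using onorm_pos_le[OF T(1)] T(3) by (simp add: positive_op_def)
  ultimately show ?thesis
    by (cases "T x = 0") (simp, rule mult_right_le_imp_le[of _ "(norm ?y)\<^sup>2"], simp_all)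
qed

lemma onorm_approx:
  fixes D :: "'a::real_inner \<Rightarrow> 'a"
  assumes D: "bounded_linear D" and "onorm D > 0"
  obtains x :: "nat \<Rightarrow> 'a" where "\<And>n. norm (x n) = 1" "(\<lambda>n. norm (D (x n))) \<longlonglongrightarrow> onorm D"
proof -
  have "\<exists>x. norm x = 1 \<and> norm (D x) > onorm D - 1 / real (Suc n)" for n
  proof (rule ccontr)
    interpret D: bounded_linear D by fact
    \<comment> \<open>The cut at 0 gives the nonnegative constant that \<open>onorm_bound\<close>
      asks for; as \<open>onorm D > 0\<close>, it is still strictly below
      \<open>onorm D\<close>.\<close>
    let ?c = "max 0 (onorm D - 1 / real (Suc n))"
    assume asm: "\<nexists>x. norm x = 1 \<and> norm (D x) > onorm D - 1 / real (Suc n)"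
    have "norm (D x) \<le> ?c * norm x" for x
    proof (cases "x = 0")
      case False
      have "norm (D ((1 / norm x) *\<^sub>R x)) \<le> onorm D - 1 / real (Suc n)"
        using asm False by (metis (no_types, opaque_lifting) linorder_not_le norm_scaleR
            abs_norm_cancel abs_divide abs_one divide_eq_eq mult.commute nonzero_mult_div_cancel_left
            norm_eq_zero times_divide_eq_left mult_1)
      then have "norm (D x) / norm x \<le> ?c" by (simp add: D.scaleR)
      then show ?thesis using False by (simp add: field_simps)
    qed (simp add: D.zero)
    then have "onorm D \<le> ?c" by (intro onorm_bound) auto
    moreover have "0 < 1 / real (Suc n)" by simp
    ultimately show False using assms(2) by linarith
  qed
  then obtain x where x: "\<And>n. norm (x n) = 1"
    "\<And>n. norm (D (x n)) > onorm D - 1 / real (Suc n)" by metis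
  have "(\<lambda>n. onorm D - 1 / real (Suc n)) \<longlonglongrightarrow> onorm D - 0"
    by (intro tendsto_intros LIMSEQ_Suc lim_1_over_n)
  then have "(\<lambda>n. onorm D - 1 / real (Suc n)) \<longlonglongrightarrow> onorm D" by simp
  from this tendsto_const have "(\<lambda>n. norm (D (x n))) \<longlonglongrightarrow> onorm D"
  proof (rule tendsto_sandwich[rotated 2])
    show "\<forall>\<^sub>F n in sequentially. onorm D - 1 / real (Suc n) \<le> norm (D (x n))"
      using x(2) by (intro eventuallyI less_imp_le)
    show "\<forall>\<^sub>F n in sequentially. norm (D (x n)) \<le> onorm D"
      using x(1) by (intro eventuallyI onorm_norm_le[OF D]) simp
  qed
  then show ?thesis using that x(1) by blast
qed

text \<open>If \<open>A\<^sup>2 = R\<^sup>2\<close>, then \<open>S = A + R\<close> anticommutes with \<open>D = A - R\<close>. On an approximate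
  eigenvector \<open>x\<close> of \<open>D\<^sup>2\<close> with eigenvalue \<open>\<parallel>D\<parallel>\<^sup>2\<close>, this makes
  \<open>\<parallel>D\<parallel>\<^sup>2 \<langle>x, S x\<rangle> \<approx> \<langle>D\<^sup>2 x, S x\<rangle> = - \<langle>D x, S D x\<rangle> \<le> 0\<close>, so that \<open>A x\<close> and \<open>R x\<close> are small,
  hence so is \<open>D x\<close>.\<close>

lemma positive_sqrt_unique:
  fixes A R :: "'a::real_inner \<Rightarrow> 'a"
  assumes A: "bounded_linear A" "self_adjoint_op A" "positive_op A"
    and R: "bounded_linear R" "self_adjoint_op R" "positive_op R"
    and sq: "A \<circ> A = R \<circ> R"
  shows "A = R"
proof (rule ccontr)
  assume "A \<noteq> R"
  interpret A: bounded_linear A by fact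
  interpret R: bounded_linear R by fact
  define D where "D x = A x - R x" for x
  define S where "S x = A x + R x" for x
  have D: "bounded_linear D" and S: "bounded_linear S"
    unfolding D_def[abs_def] S_def[abs_def]
    using A(1) R(1) by (auto intro: bounded_linear_sub bounded_linear_add)
  have sym: "D x \<bullet> y = x \<bullet> D y" for x y
    using A(2) R(2) by (simp add: D_def self_adjoint_op_def inner_diff_left inner_diff_right)
  have sq': "A (A x) = R (R x)" for x using sq by (metis comp_apply)
  have anti: "S (D x) = - D (S x)" for x
    by (simp add: S_def D_def A.add A.diff R.add R.diff sq')
  define d where "d = onorm D"
  have "d > 0"
    using \<open>A \<noteq> R\<close> onorm_pos_lt[OF D] by (auto simp: d_def D_def fun_eq_iff)
  then obtain x :: "nat \<Rightarrow> 'a" where x: "\<And>n. norm (x n) = 1" "(\<lambda>n. norm (D (x n))) \<longlonglongrightarrow> d"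
    using onorm_approx[OF D] unfolding d_def by metis
  define w where "w n = D (D (x n)) - d\<^sup>2 *\<^sub>R x n" for n
  \<comment> \<open>By symmetry of \<open>D\<close> the cross term of \<open>|w n|^2\<close> is
    \<open>- 2 * d^2 * |D (x n)|^2\<close>, and \<open>|D (D (x n))| \<le> d^2\<close>. Since
    \<open>|D (x n)|\<close> tends to \<open>d\<close>, the right-hand side tends to 0.\<close>
  have w_le: "(norm (w n))\<^sup>2 \<le> 2 * d^4 - 2 * d\<^sup>2 * (norm (D (x n)))\<^sup>2" for n
  proof -
    have "norm (D (D (x n))) \<le> d * norm (D (x n))" "norm (D (x n)) \<le> d"
      using onorm[OF D, of "D (x n)"] onorm_norm_le[OF D, of "x n"] x(1) by (auto simp: d_def)
    then have "norm (D (D (x n))) \<le> d\<^sup>2"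
      using \<open>d > 0\<close> by (smt (verit) mult_left_mono power2_eq_square)
    then have "(norm (D (D (x n))))\<^sup>2 \<le> (d\<^sup>2)\<^sup>2" by (intro power_mono) auto
    moreover have "(norm (w n))\<^sup>2 =
        (norm (D (D (x n))))\<^sup>2 - 2 * d\<^sup>2 * (norm (D (x n)))\<^sup>2 + (d\<^sup>2)\<^sup>2 * (norm (x n))\<^sup>2"
      unfolding w_def power2_norm_eq_inner
      using sym[of "D (x n)" "x n"]
      by (simp add: inner_diff_left inner_diff_right inner_commute power2_eq_square algebra_simps)
    ultimately show ?thesis using x(1)[of n] by simp
  qed
  have "(\<lambda>n. 2 * d^4 - 2 * d\<^sup>2 * (norm (D (x n)))\<^sup>2) \<longlonglongrightarrow> 2 * d^4 - 2 * d\<^sup>2 * d\<^sup>2"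
    by (intro tendsto_intros x)
  moreover have "2 * d^4 - 2 * d\<^sup>2 * d\<^sup>2 = 0" by (simp add: power2_eq_square power4_eq_xxxx)
  ultimately have "(\<lambda>n. 2 * d^4 - 2 * d\<^sup>2 * (norm (D (x n)))\<^sup>2) \<longlonglongrightarrow> 0" by simp
  then have "(\<lambda>n. (norm (w n))\<^sup>2) \<longlonglongrightarrow> 0"
    by (rule Lim_null_comparison[rotated]) (simp add: w_le)
  then have "(\<lambda>n. sqrt ((norm (w n))\<^sup>2)) \<longlonglongrightarrow> sqrt 0" by (intro tendsto_real_sqrt)
  then have w0: "(\<lambda>n. norm (w n)) \<longlonglongrightarrow> 0" by simp
  define s where "s n = x n \<bullet> S (x n)" for n
  have s_ge: "x n \<bullet> A (x n) \<le> s n" "x n \<bullet> R (x n) \<le> s n" for n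
    using A(3) R(3) by (auto simp: s_def S_def inner_add_right positive_op_def)
  have s_le: "s n \<le> norm (w n) * onorm S / d\<^sup>2" for n
  proof -
    have "0 \<le> D (x n) \<bullet> S (D (x n))"
      using A(3) R(3) by (simp add: S_def inner_add_right positive_op_def)
    also have "\<dots> = - (D (D (x n)) \<bullet> S (x n))" by (simp add: anti sym)
    also have "\<dots> = - (w n \<bullet> S (x n)) - d\<^sup>2 * s n"
      by (simp add: w_def s_def inner_diff_left)
    also have "- (w n \<bullet> S (x n)) \<le> norm (w n) * norm (S (x n))"
      using norm_cauchy_schwarz[of "- w n" "S (x n)"] by simp
    also have "\<dots> \<le> norm (w n) * onorm S"
      using onorm_norm_le[OF S, of "x n"] x(1) by (intro mult_left_mono) auto
    finally show ?thesis using \<open>d > 0\<close> by (simp add: field_simps)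
  qed
  have small: "(\<lambda>n. T (x n)) \<longlonglongrightarrow> 0"
    if T: "bounded_linear T" "self_adjoint_op T" "positive_op T" and "\<And>n. x n \<bullet> T (x n) \<le> s n"
    for T :: "'a \<Rightarrow> 'a"
  proof -
    have "(norm (T (x n)))\<^sup>2 \<le> onorm T * (norm (w n) * onorm S / d\<^sup>2)" for n
      using norm_positive_op_le[OF T, of "x n"] that(4)[of n] s_le[of n]
        mult_left_mono[of "x n \<bullet> T (x n)" "norm (w n) * onorm S / d\<^sup>2" "onorm T"]
        onorm_pos_le[OF T(1)] by linarith
    then have le: "\<forall>\<^sub>F n in sequentially.
        norm ((norm (T (x n)))\<^sup>2) \<le> onorm T * (norm (w n) * onorm S / d\<^sup>2)"
      by simp
    have "(\<lambda>n. onorm T * (norm (w n) * onorm S / d\<^sup>2)) \<longlonglongrightarrow> onorm T * (0 * onorm S / d\<^sup>2)"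
      using \<open>d > 0\<close> by (intro tendsto_intros w0) auto
    then have "(\<lambda>n. (norm (T (x n)))\<^sup>2) \<longlonglongrightarrow> 0"
      using le by (intro Lim_null_comparison[OF le]) simp
    then have "(\<lambda>n. sqrt ((norm (T (x n)))\<^sup>2)) \<longlonglongrightarrow> sqrt 0" by (intro tendsto_real_sqrt)
    then show ?thesis by (simp add: tendsto_norm_zero_iff)
  qed
  have "(\<lambda>n. norm (A (x n) - R (x n))) \<longlonglongrightarrow> norm (0 - 0 :: 'a)"
    by (intro tendsto_intros small A R s_ge)
  then have "d = 0" using x(2) LIMSEQ_unique by (fastforce simp: D_def)
  then show False using \<open>d > 0\<close> by simp
qed

section \<open>Approximation along a basis and transfer of traces between bases\<close>

text \<open>Distinct members are at distance \<open>sqrt 2\<close>, so balls of radius 1/2 around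
  them are disjoint, and a second-countable space has only countably many disjoint nonempty open
  sets.\<close>

lemma orthonormal_countable:
  fixes B :: "'a::{real_inner, second_countable_topology} set"
  assumes "orthonormal B"
  shows "countable B"
proof -
  have far: "1 \<le> dist x y" if "x \<in> B" "y \<in> B" "x \<noteq> y" for x y
  proof -
    have "(dist x y)\<^sup>2 = 2"
      using orthonormal_inner[OF assms] that
      by (simp add: dist_norm power2_norm_eq_inner inner_diff_left inner_diff_right)
    then have "1\<^sup>2 \<le> (dist x y)\<^sup>2" by simp
    then show ?thesis by (rule power2_le_imp_le) simp
  qed
  have disj: "ball x (1/2) \<inter> ball y (1/2) = {}" if "x \<in> B" "y \<in> B" "x \<noteq> y" for x y
  proof (intro equals0I, elim IntE)
    fix z assume "z \<in> ball x (1/2)" "z \<in> ball y (1/2)"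
    then have "dist x z < 1/2" "dist z y < 1/2" by (auto simp: dist_commute)
    then show False using far[OF that] dist_triangle[of x y z] by linarith
  qed
  have "countable ((\<lambda>x. ball x (1/2)) ` B)"
    by (rule countable_disjoint_open_subsets) (use disj in \<open>auto simp: disjoint_def\<close>)
  moreover have "inj_on (\<lambda>x. ball x (1/2)) B"
  proof (rule inj_onI, rule ccontr)
    fix x y assume "x \<in> B" "y \<in> B" "ball x (1/2) = ball y (1/2)" "x \<noteq> y"
    then show False using disj[of x y] centre_in_ball[of x "1/2"] by auto
  qed
  ultimately show ?thesis by (simp add: countable_image_inj_eq)
qed

text \<open>\<open>F n\<close> holds the members of index below \<open>n\<close> in an enumeration
  of \<open>B\<close>. Every \<open>y\<close> in \<open>span B\<close> lies in
  \<open>span (F n)\<close> for large \<open>n\<close>, so best approximation and density give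
  convergence. For finite \<open>B\<close> the sequence is eventually constant.\<close>

lemma orthonormal_basis_approx:
  fixes B :: "'a::{real_inner, second_countable_topology} set"
  assumes "orthonormal_basis B"
  obtains F :: "nat \<Rightarrow> 'a set" where "\<And>n. finite (F n)" "\<And>n. F n \<subseteq> B" "incseq F"
    "\<And>x. (\<lambda>n. proj (F n) x) \<longlonglongrightarrow> x"
proof -
  have B: "orthonormal B" "closure (span B) = UNIV"
    using assms by (auto simp: orthonormal_basis_def orthonormal_def)
  have cB: "countable B" by (rule orthonormal_countable[OF B(1)])
  define F where "F n = {b \<in> B. to_nat_on B b < n}" for n
  have fin: "finite (F n)" for n
  proof (rule finite_imageD)
    show "finite (to_nat_on B ` F n)"
      by (rule finite_subset[of _ "{..<n}"]) (auto simp: F_def)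
    show "inj_on (to_nat_on B) (F n)"
      using inj_on_to_nat_on[OF cB] by (rule inj_on_subset) (auto simp: F_def)
  qed
  have sub: "F n \<subseteq> B" for n by (auto simp: F_def)
  have inc: "incseq F" by (auto simp: incseq_def F_def)
  have "(\<lambda>n. proj (F n) x) \<longlonglongrightarrow> x" for x
  proof (rule LIMSEQ_I)
    fix r :: real assume "0 < r"
    then obtain y where y: "y \<in> span B" "dist y x < r"
      using B(2) closure_approachable[of x "span B"] by auto
    then obtain C c where C': "finite C" "C \<subseteq> B" "y = (\<Sum>b\<in>C. c b *\<^sub>R b)"
      unfolding span_explicit by blast
    then have C: "finite C" "C \<subseteq> B" "y \<in> span C"
      by (auto intro!: span_sum span_scale intro: span_base)
    obtain N where N: "C \<subseteq> F N"
    proof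
      show "C \<subseteq> F (Suc (Max (to_nat_on B ` C)))"
        using C by (auto simp: F_def less_Suc_eq_le)
    qed
    have "norm (proj (F n) x - x) < r" if "n \<ge> N" for n
    proof -
      have "C \<subseteq> F n" using N inc that unfolding incseq_def by blast
      then have "y \<in> span (F n)" using C(3) span_mono by blast
      then have "norm (x - proj (F n) x) \<le> norm (x - y)"
        by (intro norm_diff_proj fin orthonormal_subset[OF B(1) sub])
      then show ?thesis using y(2) by (simp add: dist_norm norm_minus_commute)
    qed
    then show "\<exists>N. \<forall>n\<ge>N. norm (proj (F n) x - x) < r" by blast
  qed
  then show ?thesis using that fin sub inc by blast
qed

text \<open>In a basis \<open>G\<close> diagonalising the form on \<open>span F\<close>, the left
  side weights each \<open>g \<bullet> R g \<ge> 0\<close> by the sum of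
  \<open>(g \<bullet> e)^2\<close> over \<open>E\<close>, which is at most 1 by Bessel.\<close>

lemma sum_compression_le:
  fixes R :: "'a::real_inner \<Rightarrow> 'a"
  assumes E: "finite E" "orthonormal E" and F: "finite F" "orthonormal F"
    and R: "bounded_linear R" "self_adjoint_op R" "positive_op R"
  shows "(\<Sum>e\<in>E. proj F e \<bullet> R (proj F e)) \<le> (\<Sum>f\<in>F. f \<bullet> R f)"
proof -
  interpret R: bounded_linear R by fact
  obtain G where G: "finite G" "orthonormal G" "span G = span F"
    "\<And>f g. f \<in> G \<Longrightarrow> g \<in> G \<Longrightarrow> f \<noteq> g \<Longrightarrow> f \<bullet> R g = 0"
    using finite_spectral_basis[OF F R(1,2)] by metis
  have form: "p \<bullet> R p = (\<Sum>g\<in>G. (g \<bullet> p)\<^sup>2 * (g \<bullet> R g))" if "p \<in> span F" for p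
  proof -
    have "p \<bullet> R p = proj G p \<bullet> R (proj G p)"
      using that G by (simp add: proj_span)
    also have "\<dots> = (\<Sum>g\<in>G. \<Sum>h\<in>G. (g \<bullet> p) * ((h \<bullet> p) * (h \<bullet> R g)))"
      by (simp add: proj_def R.sum R.scaleR inner_sum_left inner_sum_right sum_distrib_left)
    also have "\<dots> = (\<Sum>g\<in>G. \<Sum>h\<in>G. if h = g then (g \<bullet> p)\<^sup>2 * (g \<bullet> R g) else 0)"
      using G(4) by (intro sum.cong) (auto simp: power2_eq_square)
    finally show ?thesis using G(1) by simp
  qed
  have "(\<Sum>e\<in>E. proj F e \<bullet> R (proj F e)) = (\<Sum>e\<in>E. \<Sum>g\<in>G. (g \<bullet> proj F e)\<^sup>2 * (g \<bullet> R g))"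
    by (simp add: form proj_in_span)
  also have "\<dots> = (\<Sum>g\<in>G. (\<Sum>e\<in>E. (g \<bullet> proj F e)\<^sup>2) * (g \<bullet> R g))"
    by (subst sum.swap) (simp add: sum_distrib_right)
  also have "\<dots> \<le> (\<Sum>g\<in>G. g \<bullet> R g)"
  proof (rule sum_mono)
    fix g assume g: "g \<in> G"
    have "g \<bullet> proj F e = g \<bullet> e" for e
      using g G(3) span_base[OF g] by (intro inner_proj F) auto
    then have "(\<Sum>e\<in>E. (g \<bullet> proj F e)\<^sup>2) \<le> 1"
      using bessel[OF E, of g] orthonormal_norm[OF G(2) g] by (simp add: inner_commute)
    then show "(\<Sum>e\<in>E. (g \<bullet> proj F e)\<^sup>2) * (g \<bullet> R g) \<le> g \<bullet> R g"
      using R(3) by (intro mult_left_le_one_le) (auto simp: positive_op_def intro: sum_nonneg)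
  qed
  also have "\<dots> = (\<Sum>f\<in>F. f \<bullet> R f)"
    by (rule trace_span_eq) (use G F R in \<open>auto intro: bounded_linear.linear\<close>)
  finally show ?thesis .
qed

text \<open>Compress to finite parts of \<open>B\<close> and let these exhaust \<open>B\<close>.
  Applied to finite subsets of another basis, it transfers summability between bases.\<close>

lemma finite_trace_le_infsum:
  fixes R :: "'a::{real_inner, second_countable_topology} \<Rightarrow> 'a"
  assumes R: "bounded_linear R" "self_adjoint_op R" "positive_op R"
    and B: "orthonormal_basis B" "(\<lambda>b. b \<bullet> R b) summable_on B"
    and E: "finite E" "orthonormal E"
  shows "(\<Sum>e\<in>E. e \<bullet> R e) \<le> (\<Sum>\<^sub>\<infinity>b\<in>B. b \<bullet> R b)"
proof -
  interpret R: bounded_linear R by fact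
  obtain F where F: "\<And>n. finite (F n)" "\<And>n. F n \<subseteq> B" "incseq F"
    "\<And>x. (\<lambda>n. proj (F n) x) \<longlonglongrightarrow> x"
    using orthonormal_basis_approx[OF B(1)] by metis
  have oB: "orthonormal B" using B(1) by (simp add: orthonormal_basis_def orthonormal_def)
  have "(\<lambda>n. \<Sum>e\<in>E. proj (F n) e \<bullet> R (proj (F n) e)) \<longlonglongrightarrow> (\<Sum>e\<in>E. e \<bullet> R e)"
    by (intro tendsto_intros F R.tendsto)
  moreover have "(\<Sum>e\<in>E. proj (F n) e \<bullet> R (proj (F n) e)) \<le> (\<Sum>\<^sub>\<infinity>b\<in>B. b \<bullet> R b)" for n
  proof -
    have "(\<Sum>e\<in>E. proj (F n) e \<bullet> R (proj (F n) e)) \<le> (\<Sum>f\<in>F n. f \<bullet> R f)"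
      by (intro sum_compression_le E F R orthonormal_subset[OF oB])
    also have "\<dots> \<le> (\<Sum>\<^sub>\<infinity>b\<in>B. b \<bullet> R b)"
      using R(3) by (intro finite_sum_le_infsum B F) (auto simp: positive_op_def)
    finally show ?thesis .
  qed
  ultimately show ?thesis by (blast intro: LIMSEQ_le_const2)
qed

text \<open>\<open>trace_class\<close> speaks of \<open>|R|\<close> and of one unspecified basis,
  while \<open>op_trace\<close> and \<open>hs_norm\<close> use a fixed one. Uniqueness of the
  positive square root gives \<open>|R| = R\<close>, and bounded partial traces carry summability
  over to \<open>C\<close>.\<close>

lemma trace_class_summable:
  fixes R :: "'a::{real_inner, second_countable_topology} \<Rightarrow> 'a"
  assumes R: "trace_class R" "self_adjoint_op R" "positive_op R" and "orthonormal_basis C"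
  shows "(\<lambda>e. e \<bullet> R e) summable_on C" "(\<lambda>e. (norm (R e))\<^sup>2) summable_on C"
proof -
  have lin: "bounded_linear R" using R(1) by (simp add: trace_class_def)
  obtain A B where A: "bounded_linear A" "self_adjoint_op A" "positive_op A" "A \<circ> A = adjoint R \<circ> R"
    and B: "orthonormal_basis B" "(\<lambda>e. e \<bullet> A e) summable_on B"
    using R(1) unfolding trace_class_def by blast
  have C: "orthonormal C"
    using assms(4) by (simp add: orthonormal_basis_def orthonormal_def)
  have "A = R"
    using A(4) unfolding adjoint_self_adjoint_op[OF R(2)]
    by (rule positive_sqrt_unique[OF A(1-3) lin R(2,3)])
  show 1: "(\<lambda>e. e \<bullet> R e) summable_on C"
  proof (rule nonneg_bdd_above_summable_on)
    show "0 \<le> e \<bullet> R e" for e using R(3) by (simp add: positive_op_def)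
    show "bdd_above (sum (\<lambda>e. e \<bullet> R e) ` {F. F \<subseteq> C \<and> finite F})"
    proof (rule bdd_aboveI2)
      fix F assume "F \<in> {F. F \<subseteq> C \<and> finite F}"
      then show "(\<Sum>e\<in>F. e \<bullet> R e) \<le> (\<Sum>\<^sub>\<infinity>b\<in>B. b \<bullet> R b)"
        using B(2) finite_trace_le_infsum[OF lin R(2,3) B(1)] orthonormal_subset[OF C, of F]
        by (simp add: \<open>A = R\<close>)
    qed
  qed
  have "(\<lambda>e. onorm R * (e \<bullet> R e)) summable_on C"
    by (rule summable_on_cmult_right[OF 1])
  then show "(\<lambda>e. (norm (R e))\<^sup>2) summable_on C"
  proof (rule summable_on_comparison_test)
    show "(norm (R e))\<^sup>2 \<le> onorm R * (e \<bullet> R e)" for e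
      by (rule norm_positive_op_le[OF lin R(2,3)])
  qed simp
qed

section \<open>Exponential moments\<close>

lemma nn_integral_normal_density:
  assumes "0 < \<sigma>"
  shows "(\<integral>\<^sup>+x. ennreal (normal_density \<mu> \<sigma> x) \<partial>lborel) = 1"
  using assms by (simp add: nn_integral_eq_integral normal_density_nonneg)

text \<open>Completing the square turns the integrand into \<open>exp (a^2 / 2)\<close> times the
  normal density of mean \<open>a\<close> and variance 1.\<close>

lemma nn_integral_std_normal_exp_linear:
  "(\<integral>\<^sup>+x. ennreal (std_normal_density x * exp (a * x)) \<partial>lborel) = ennreal (exp (a\<^sup>2 / 2))"
proof -
  have "std_normal_density x * exp (a * x) = exp (a\<^sup>2 / 2) * normal_density a 1 x" for x
    by (simp add: normal_density_def exp_add[symmetric] power2_eq_square field_simps)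
  then show ?thesis
    by (simp add: ennreal_mult' nn_integral_cmult nn_integral_normal_density)
qed

text \<open>The integrand is \<open>\<sigma>\<close> times the centered normal density of variance
  \<open>\<sigma>^2 = 1 / (1 - 2 m)\<close>.\<close>

lemma nn_integral_std_normal_exp_square:
  assumes "2 * m < 1"
  shows "(\<integral>\<^sup>+x. ennreal (std_normal_density x * exp (m * x\<^sup>2)) \<partial>lborel)
    = ennreal (1 / sqrt (1 - 2 * m))"
proof -
  define \<sigma> where "\<sigma> = 1 / sqrt (1 - 2 * m)"
  have \<sigma>: "0 < \<sigma>" "\<sigma>\<^sup>2 = 1 / (1 - 2 * m)" using assms by (auto simp: \<sigma>_def power_divide)
  have "std_normal_density x * exp (m * x\<^sup>2) = \<sigma> * normal_density 0 \<sigma> x" for x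
  proof -
    have "sqrt (2 * pi * \<sigma>\<^sup>2) = sqrt (2 * pi) * \<sigma>" using \<sigma>(1) by (simp add: real_sqrt_mult)
    moreover have "- x\<^sup>2 / 2 + m * x\<^sup>2 = - (x\<^sup>2) / (2 * \<sigma>\<^sup>2)"
      using assms by (simp add: \<sigma>(2) field_simps)
    ultimately show ?thesis
      using \<sigma>(1) by (simp add: normal_density_def exp_add[symmetric])
  qed
  then show ?thesis
    using \<sigma>(1) by (simp add: ennreal_mult' nn_integral_cmult nn_integral_normal_density \<sigma>_def[symmetric])
qed

text \<open>The Gaussian integral \<open>exp (l y\<^sup>2) = \<integral> exp (\<surd>(2l) y g) d\<gamma>(g)\<close> turns one square at a time into
  a shift of the linear term \<open>u\<close>, which is controlled by the subgaussian hypothesis.\<close>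

lemma subgaussian_exp_sum_squares:
  fixes X :: "'b \<Rightarrow> 'a::{real_inner, second_countable_topology}" and R :: "'a \<Rightarrow> 'a"
  assumes M: "prob_space M" and X[measurable]: "X \<in> borel_measurable M"
    and R: "bounded_linear R" "self_adjoint_op R"
    and sub: "\<And>u. (\<integral>\<^sup>+\<omega>. ennreal (exp (u \<bullet> X \<omega>)) \<partial>M) \<le> ennreal (exp (1 / 2 * (u \<bullet> R u)))"
    and l: "0 \<le> l"
    and F: "finite F" "\<And>f g. f \<in> F \<Longrightarrow> g \<in> F \<Longrightarrow> f \<noteq> g \<Longrightarrow> f \<bullet> R g = 0"
      "\<And>f. f \<in> F \<Longrightarrow> 2 * l * (f \<bullet> R f) < 1" "\<And>f. f \<in> F \<Longrightarrow> u \<bullet> R f = 0"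
  shows "(\<integral>\<^sup>+\<omega>. ennreal (exp (l * (\<Sum>f\<in>F. (f \<bullet> X \<omega>)\<^sup>2) + u \<bullet> X \<omega>)) \<partial>M)
    \<le> ennreal (exp (1 / 2 * (u \<bullet> R u)) * (\<Prod>f\<in>F. 1 / sqrt (1 - 2 * l * (f \<bullet> R f))))"
  using F
\<comment> \<open>\<open>u\<close> stays arbitrary because linearising the square of
  \<open>f \<bullet> X\<close> moves it to \<open>u + (a * g) f\<close>.\<close>
proof (induction F arbitrary: u rule: finite_induct)
  case empty
  then show ?case using sub[of u] by simp
next
  case (insert f F)
  interpret prob_space M by fact
  interpret R: bounded_linear R by fact
  interpret pair_sigma_finite lborel M ..
  define a where "a = sqrt (2 * l)"
  define P where "P = (\<Prod>f\<in>F. 1 / sqrt (1 - 2 * l * (f \<bullet> R f)))"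
  have a2: "a\<^sup>2 = 2 * l" using l by (simp add: a_def)
  have P: "0 \<le> P" unfolding P_def
    using insert.prems(2) by (intro prod_nonneg) (auto simp: less_imp_le)
  let ?rest = "\<lambda>\<omega>. l * (\<Sum>f\<in>F. (f \<bullet> X \<omega>)\<^sup>2)"
  have "(\<integral>\<^sup>+\<omega>. ennreal (exp (l * (\<Sum>f\<in>insert f F. (f \<bullet> X \<omega>)\<^sup>2) + u \<bullet> X \<omega>)) \<partial>M)
      = (\<integral>\<^sup>+\<omega>. (\<integral>\<^sup>+g. ennreal (std_normal_density g) *
          ennreal (exp (?rest \<omega> + (u + (a * g) *\<^sub>R f) \<bullet> X \<omega>)) \<partial>lborel) \<partial>M)"
  proof (rule nn_integral_cong)
    fix \<omega>
    let ?y = "f \<bullet> X \<omega>" and ?r = "?rest \<omega> + u \<bullet> X \<omega>"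
    have "exp (l * (\<Sum>f\<in>insert f F. (f \<bullet> X \<omega>)\<^sup>2) + u \<bullet> X \<omega>) = exp ?r * exp ((a * ?y)\<^sup>2 / 2)"
      using insert.hyps by (simp add: exp_add[symmetric] power_mult_distrib a2 algebra_simps)
    then have "ennreal (exp (l * (\<Sum>f\<in>insert f F. (f \<bullet> X \<omega>)\<^sup>2) + u \<bullet> X \<omega>))
        = ennreal (exp ?r) * (\<integral>\<^sup>+g. ennreal (std_normal_density g * exp (a * ?y * g)) \<partial>lborel)"
      by (simp only: nn_integral_std_normal_exp_linear ennreal_mult' exp_ge_zero)
    also have "\<dots> = (\<integral>\<^sup>+g. ennreal (exp ?r) * ennreal (std_normal_density g * exp (a * ?y * g)) \<partial>lborel)"
      by (rule nn_integral_cmult[symmetric]) simp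
    also have "\<dots> = (\<integral>\<^sup>+g. ennreal (std_normal_density g) *
        ennreal (exp (?rest \<omega> + (u + (a * g) *\<^sub>R f) \<bullet> X \<omega>)) \<partial>lborel)"
    proof (rule nn_integral_cong)
      fix g
      have "exp ?r * (std_normal_density g * exp (a * ?y * g))
          = std_normal_density g * exp (?rest \<omega> + (u + (a * g) *\<^sub>R f) \<bullet> X \<omega>)"
        by (simp add: exp_add inner_add_left ac_simps)
      then show "ennreal (exp ?r) * ennreal (std_normal_density g * exp (a * ?y * g))
          = ennreal (std_normal_density g) * ennreal (exp (?rest \<omega> + (u + (a * g) *\<^sub>R f) \<bullet> X \<omega>))"
        by (simp only: ennreal_mult'[symmetric] exp_ge_zero normal_density_nonneg)
    qed
    finally show "ennreal (exp (l * (\<Sum>f\<in>insert f F. (f \<bullet> X \<omega>)\<^sup>2) + u \<bullet> X \<omega>)) =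
        (\<integral>\<^sup>+g. ennreal (std_normal_density g) *
          ennreal (exp (?rest \<omega> + (u + (a * g) *\<^sub>R f) \<bullet> X \<omega>)) \<partial>lborel)" .
  qed
  also have "\<dots> = (\<integral>\<^sup>+g. (\<integral>\<^sup>+\<omega>. ennreal (std_normal_density g) *
          ennreal (exp (?rest \<omega> + (u + (a * g) *\<^sub>R f) \<bullet> X \<omega>)) \<partial>M) \<partial>lborel)"
    by (rule Fubini') measurable
  also have "\<dots> \<le> (\<integral>\<^sup>+g. ennreal (exp (1 / 2 * (u \<bullet> R u)) * P) *
      ennreal (std_normal_density g * exp (l * (f \<bullet> R f) * g\<^sup>2)) \<partial>lborel)"
  proof (rule nn_integral_mono)
    fix g :: real
    let ?v = "u + (a * g) *\<^sub>R f"
    \<comment> \<open>The cross terms of the form vanish, so the exponent splits into a part in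
      \<open>u\<close> and a multiple of \<open>g^2\<close>. The shifted vector is again orthogonal
      to \<open>R h\<close> for all \<open>h\<close> in \<open>F\<close>, as the induction
      hypothesis asks.\<close>
    have uf: "u \<bullet> R f = 0" using insert.prems by simp
    then have "f \<bullet> R u = 0" using R(2) by (metis inner_commute self_adjoint_op_def)
    then have v: "1 / 2 * (?v \<bullet> R ?v) = 1 / 2 * (u \<bullet> R u) + l * (f \<bullet> R f) * g\<^sup>2"
      using uf a2
      by (simp add: R.add R.scaleR inner_add_left inner_add_right power2_eq_square algebra_simps)
    have "?v \<bullet> R h = 0" if "h \<in> F" for h
      using that insert.hyps insert.prems by (auto simp: inner_add_left)
    then have "(\<integral>\<^sup>+\<omega>. ennreal (exp (?rest \<omega> + ?v \<bullet> X \<omega>)) \<partial>M)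
        \<le> ennreal (exp (1 / 2 * (?v \<bullet> R ?v)) * P)"
      unfolding P_def using insert.prems by (intro insert.IH) auto
    then have "ennreal (std_normal_density g) * (\<integral>\<^sup>+\<omega>. ennreal (exp (?rest \<omega> + ?v \<bullet> X \<omega>)) \<partial>M)
        \<le> ennreal (std_normal_density g) * ennreal (exp (1 / 2 * (?v \<bullet> R ?v)) * P)"
      by (rule mult_left_mono) simp
    also have "\<dots> = ennreal (exp (1 / 2 * (u \<bullet> R u)) * P) *
        ennreal (std_normal_density g * exp (l * (f \<bullet> R f) * g\<^sup>2))"
      unfolding v exp_add using P
      by (simp add: ennreal_mult'[symmetric] ennreal_mult''[symmetric] ac_simps)
    finally show "(\<integral>\<^sup>+\<omega>. ennreal (std_normal_density g) * ennreal (exp (?rest \<omega> + ?v \<bullet> X \<omega>)) \<partial>M)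
        \<le> ennreal (exp (1 / 2 * (u \<bullet> R u)) * P) *
          ennreal (std_normal_density g * exp (l * (f \<bullet> R f) * g\<^sup>2))"
      by (simp add: nn_integral_cmult)
  qed
  also have "\<dots> = ennreal (exp (1 / 2 * (u \<bullet> R u)) * P) * ennreal (1 / sqrt (1 - 2 * (l * (f \<bullet> R f))))"
    using insert.prems(2)[of f]
    by (subst nn_integral_cmult, simp, subst nn_integral_std_normal_exp_square) (simp_all add: mult.assoc)
  also have "\<dots> = ennreal (exp (1 / 2 * (u \<bullet> R u)) * (\<Prod>f\<in>insert f F. 1 / sqrt (1 - 2 * l * (f \<bullet> R f))))"
    using insert.hyps insert.prems(2)[of f] P
    by (simp add: ennreal_mult'[symmetric] P_def mult.assoc mult.commute mult.left_commute)
  finally show ?case .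
qed

section \<open>Scalar inequalities, logarithmic moments and the Chernoff bound\<close>

text \<open>Both sides vanish at 1, and the derivative of their difference is
  \<open>(1 - 1 / x)^2 / 2\<close>.\<close>

lemma ln_le_half_diff_inverse:
  fixes z :: real
  assumes "1 \<le> z"
  shows "ln z \<le> (z - 1 / z) / 2"
proof -
  have "(1 - 1 / 1) / 2 - ln 1 \<le> (z - 1 / z) / 2 - ln z"
  proof (rule DERIV_nonneg_imp_nondecreasing[OF assms])
    fix x :: real assume x: "1 \<le> x" "x \<le> z"
    have "((\<lambda>x. (x - 1 / x) / 2 - ln x) has_real_derivative (1 - 1 / x)\<^sup>2 / 2) (at x)"
      using x by (auto intro!: derivative_eq_intros simp: field_simps power2_eq_square)
    then show "\<exists>y. ((\<lambda>x. (x - 1 / x) / 2 - ln x) has_real_derivative y) (at x) \<and> 0 \<le> y"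
      by (intro exI[of _ "(1 - 1 / x)\<^sup>2 / 2"]) simp
  qed
  then show ?thesis by simp
qed

text \<open>For \<open>z = 1 / (1 - 2 x)\<close> the logarithmic bound becomes exactly
  \<open>x + x^2 / (1 - 2 x)\<close>. A common \<open>y\<close> for all eigenvalues \<open>x\<close>
  lets the factors combine into a sum of squares over one denominator.\<close>

lemma inverse_sqrt_le_exp:
  fixes x :: real
  assumes "0 \<le> x" "x \<le> y" "2 * y < 1"
  shows "1 / sqrt (1 - 2 * x) \<le> exp (x + x\<^sup>2 / (1 - 2 * y))"
proof -
  define z where "z = 1 / (1 - 2 * x)"
  have z: "1 \<le> z" using assms by (simp add: z_def)
  have "ln (1 / sqrt (1 - 2 * x)) = 1 / 2 * ln z"
    using assms by (simp add: z_def ln_div ln_sqrt)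
  also have "\<dots> \<le> 1 / 2 * ((z - 1 / z) / 2)" using ln_le_half_diff_inverse[OF z] by simp
  also have "\<dots> = x + x\<^sup>2 / (1 - 2 * x)"
    using assms by (simp add: z_def field_simps power2_eq_square)
  also have "\<dots> \<le> x + x\<^sup>2 / (1 - 2 * y)"
    using assms by (intro add_left_mono divide_left_mono mult_pos_pos) auto
  finally have "exp (ln (1 / sqrt (1 - 2 * x))) \<le> exp (x + x\<^sup>2 / (1 - 2 * y))" by simp
  then show ?thesis using assms by simp
qed

lemma integral_exp_nonneg: "0 \<le> (\<integral>\<omega>. exp (Y \<omega> :: real) \<partial>M)"
  by (rule Bochner_Integration.integral_nonneg) simp

text \<open>A finite nonnegative integral yields integrability, so estimates can be made with
  nonnegative integrals. \<open>0 \<le> c\<close> covers the default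
  \<open>ln 0 = 0\<close>.\<close>

lemma log_moment_leI:
  assumes "Y \<in> borel_measurable M" "(\<integral>\<^sup>+\<omega>. ennreal (exp (Y \<omega>)) \<partial>M) \<le> ennreal (exp c)" "0 \<le> c"
  shows "log_moment_le M Y c"
proof -
  have int: "integrable M (\<lambda>\<omega>. exp (Y \<omega>))"
    using assms(1,2) by (intro integrableI_nonneg) (auto intro: le_less_trans)
  then have "ennreal (\<integral>\<omega>. exp (Y \<omega>) \<partial>M) \<le> ennreal (exp c)"
    using assms(2) by (simp add: nn_integral_eq_integral)
  then have le: "(\<integral>\<omega>. exp (Y \<omega>) \<partial>M) \<le> exp c" by simp
  have "ln (\<integral>\<omega>. exp (Y \<omega>) \<partial>M) \<le> c"
  proof (cases "(\<integral>\<omega>. exp (Y \<omega>) \<partial>M) = 0")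
    case False
    then have "0 < (\<integral>\<omega>. exp (Y \<omega>) \<partial>M)"
      using integral_exp_nonneg[of M Y] by linarith
    then have "ln (\<integral>\<omega>. exp (Y \<omega>) \<partial>M) \<le> ln (exp c)"
      using le by (subst ln_le_cancel_iff) simp_all
    then show ?thesis by simp
  qed (simp add: assms(3))
  then show ?thesis using int by (simp add: log_moment_le_def)
qed

lemma log_moment_leD:
  assumes "log_moment_le M Y c"
  shows "(\<integral>\<omega>. exp (Y \<omega>) \<partial>M) \<le> exp c"
proof (cases "(\<integral>\<omega>. exp (Y \<omega>) \<partial>M) = 0")
  case False
  then have pos: "0 < (\<integral>\<omega>. exp (Y \<omega>) \<partial>M)"
    using integral_exp_nonneg[of M Y] by linarith
  have "exp (ln (\<integral>\<omega>. exp (Y \<omega>) \<partial>M)) \<le> exp c"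
    using assms by (simp add: log_moment_le_def)
  then show ?thesis using pos by simp
qed simp

text \<open>Chernoff's bound at \<open>l = \<surd>t / (H + 2 \<surd>t K)\<close>, where the exponent is exactly \<open>- t\<close>.
  For \<open>H = 0\<close> this \<open>l\<close> may violate \<open>2 l K < 1\<close>, so \<open>H\<close> is first enlarged to
  \<open>H + 1 / (n + 1)\<close>, with \<open>n \<rightarrow> \<infinity>\<close> at the end.\<close>

lemma chernoff_subgamma:
  fixes Z :: "'b \<Rightarrow> real"
  assumes M: "prob_space M" and Z[measurable]: "Z \<in> borel_measurable M"
    and H: "0 \<le> H" and K: "0 \<le> K" and t: "0 \<le> t"
    and mom: "\<And>l. 0 \<le> l \<Longrightarrow> 2 * l * K < 1 \<Longrightarrow>
      log_moment_le M (\<lambda>\<omega>. l * Z \<omega>) (l * T + l\<^sup>2 * H\<^sup>2 / (1 - 2 * l * K))"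
  shows "measure M {\<omega> \<in> space M. Z \<omega> > T + 2 * sqrt t * H + 2 * t * K} \<le> exp (- t)"
proof -
  interpret prob_space M by fact
  have bound: "measure M {\<omega> \<in> space M. Z \<omega> > T + 2 * sqrt t * h + 2 * t * K} \<le> exp (- t)"
    if h: "0 < h" "H \<le> h" for h
  \<comment> \<open>For \<open>t = 0\<close> the choice of \<open>l\<close> would give 0, where
    Chernoff's bound does not apply; the claim is then that a probability is at most 1.\<close>
  proof (cases "t = 0")
    case False
    define s where "s = sqrt t"
    have s: "0 < s" "t = s\<^sup>2" using False t by (auto simp: s_def)
    define q where "q = h + 2 * s * K"
    have q: "0 < q" using h s K unfolding q_def by (intro add_pos_nonneg) auto
    define l where "l = s / q"
    have l: "0 < l" using s q by (simp add: l_def)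
    have lK: "1 - 2 * l * K = h / q" using q by (simp add: l_def q_def field_simps)
    have "0 < h / q" using h q by simp
    then have lK1: "2 * l * K < 1" using lK by linarith
    let ?c = "T + 2 * s * h + 2 * t * K" and ?m = "l * T + l\<^sup>2 * H\<^sup>2 / (1 - 2 * l * K)"
    have lm: "log_moment_le M (\<lambda>\<omega>. l * Z \<omega>) ?m" using mom l lK1 by simp
    then have int: "integrable M (\<lambda>\<omega>. exp (l * Z \<omega>))" by (simp add: log_moment_le_def)
    have "measure M {\<omega> \<in> space M. Z \<omega> > ?c} \<le> measure M {\<omega> \<in> space M. Z \<omega> \<ge> ?c}"
      by (intro finite_measure_mono) auto
    also have "\<dots> \<le> exp (- l * ?c) * (\<integral>\<omega>\<in>space M. exp (l * Z \<omega>) \<partial>M)"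
    proof (rule Chernoff_ineq_ge[OF l _ sets.top])
      show "set_integrable M (space M) (\<lambda>\<omega>. exp (l * Z \<omega>))"
        unfolding set_integrable_def by (rule integrable_mult_indicator[OF sets.top int])
    qed
    also have "(\<integral>\<omega>\<in>space M. exp (l * Z \<omega>) \<partial>M) = (\<integral>\<omega>. exp (l * Z \<omega>) \<partial>M)"
      by (rule set_integral_space[OF int])
    also have "exp (- l * ?c) * \<dots> \<le> exp (- l * ?c) * exp ?m"
      using log_moment_leD[OF lm] by simp
    also have "\<dots> \<le> exp (- t)"
    proof -
      \<comment> \<open>Since \<open>1 - 2 l K = h / q\<close>, the quadratic term is at most
        \<open>s^2 h / q\<close>. The terms with \<open>T\<close> cancel, and the threshold
        contributes \<open>- 2 s^2 (h + s K) / q\<close>; the sum is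
        \<open>- s^2 (h + 2 s K) / q = - s^2\<close>.\<close>
      have "l\<^sup>2 * H\<^sup>2 / (1 - 2 * l * K) \<le> l\<^sup>2 * h\<^sup>2 / (1 - 2 * l * K)"
        using h H lK1 by (intro divide_right_mono mult_left_mono power_mono) auto
      also have "\<dots> = s\<^sup>2 * h / q"
        unfolding lK using q h by (simp add: l_def field_simps power2_eq_square)
      finally have "- l * ?c + ?m \<le> - l * (2 * s * h + 2 * s\<^sup>2 * K) + s\<^sup>2 * h / q"
        by (simp add: s(2) algebra_simps)
      also have "\<dots> = - (s\<^sup>2 * (h + 2 * s * K)) / q"
        using q by (simp add: l_def divide_simps) (simp add: algebra_simps power2_eq_square)
      also have "\<dots> = - t" using q by (simp add: s(2) q_def[symmetric])
      finally show ?thesis by (simp add: exp_add[symmetric])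
    qed
    finally show ?thesis by (simp add: s_def)
  qed simp
  let ?A = "\<lambda>h. {\<omega> \<in> space M. Z \<omega> > T + 2 * sqrt t * h + 2 * t * K}"
  let ?h = "\<lambda>n. H + 1 / real (Suc n)"
  \<comment> \<open>The events grow as \<open>?h n\<close> decreases to \<open>H\<close>. The strict
    inequality makes their union the event for \<open>H\<close> itself, so continuity from below
    applies.\<close>
  have "(\<lambda>n. measure M (?A (?h n))) \<longlonglongrightarrow> measure M (\<Union>n. ?A (?h n))"
  proof (rule finite_Lim_measure_incseq)
    show "incseq (\<lambda>n. ?A (?h n))"
    proof (rule incseq_SucI, rule subsetI)
      fix n \<omega> assume \<omega>: "\<omega> \<in> ?A (?h n)"
      have "?h (Suc n) \<le> ?h n" by (simp add: field_simps)
      then have "2 * sqrt t * ?h (Suc n) \<le> 2 * sqrt t * ?h n" using t by (intro mult_left_mono) auto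
      then show "\<omega> \<in> ?A (?h (Suc n))" using \<omega> by auto
    qed
  qed auto
  moreover have "(\<Union>n. ?A (?h n)) = ?A H"
  proof (intro equalityI subsetI)
    fix \<omega> assume "\<omega> \<in> (\<Union>n. ?A (?h n))"
    then obtain n where n: "\<omega> \<in> ?A (?h n)" by blast
    have "2 * sqrt t * H \<le> 2 * sqrt t * ?h n" using t by (intro mult_left_mono) auto
    then show "\<omega> \<in> ?A H" using n by auto
  next
    fix \<omega> assume \<omega>: "\<omega> \<in> ?A H"
    have "(\<lambda>n. T + 2 * sqrt t * ?h n + 2 * t * K) \<longlonglongrightarrow> T + 2 * sqrt t * (H + 0) + 2 * t * K"
      by (intro tendsto_intros LIMSEQ_Suc lim_1_over_n)
    moreover have "T + 2 * sqrt t * (H + 0) + 2 * t * K < Z \<omega>" using \<omega> by simp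
    ultimately have "eventually (\<lambda>n. T + 2 * sqrt t * ?h n + 2 * t * K < Z \<omega>) sequentially"
      by (rule order_tendstoD)
    from eventually_happens'[OF sequentially_bot this]
    obtain n where "T + 2 * sqrt t * ?h n + 2 * t * K < Z \<omega>" ..
    then show "\<omega> \<in> (\<Union>n. ?A (?h n))" using \<omega> by auto
  qed
  ultimately have lim: "(\<lambda>n. measure M (?A (?h n))) \<longlonglongrightarrow> measure M (?A H)" by simp
  have le: "measure M (?A (?h n)) \<le> exp (- t)" for n
  proof (rule bound)
    show "0 < ?h n" using H by (rule add_nonneg_pos) simp
  qed simp
  show ?thesis by (rule Lim_bounded[OF lim, of 0]) (rule allI, rule impI, rule le)
qed

section \<open>Subgaussian vectors: finite-dimensional projections, then the whole space\<close>

text \<open>Pass from \<open>E\<close> to a basis \<open>F\<close> of the same span that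
  diagonalises the compression of \<open>R\<close>. The sum of squares and the trace are unchanged,
  the eigenvalues are at most \<open>onorm R\<close>, and their squares sum to at most the
  Hilbert-Schmidt sum over \<open>E\<close>.\<close>

lemma subgaussian_exp_projection:
  fixes X :: "'b \<Rightarrow> 'a::{real_inner, second_countable_topology}" and R :: "'a \<Rightarrow> 'a"
  assumes M: "prob_space M" and X: "X \<in> borel_measurable M"
    and R: "bounded_linear R" "self_adjoint_op R" "positive_op R"
    and sub: "\<And>u. (\<integral>\<^sup>+\<omega>. ennreal (exp (u \<bullet> X \<omega>)) \<partial>M) \<le> ennreal (exp (1 / 2 * (u \<bullet> R u)))"
    and l: "0 \<le> l" "2 * l * onorm R < 1"
    and E: "finite E" "orthonormal E"
  shows "(\<integral>\<^sup>+\<omega>. ennreal (exp (l * (\<Sum>e\<in>E. (e \<bullet> X \<omega>)\<^sup>2))) \<partial>M)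
    \<le> ennreal (exp (l * (\<Sum>e\<in>E. e \<bullet> R e) +
        l\<^sup>2 * (\<Sum>e\<in>E. (norm (R e))\<^sup>2) / (1 - 2 * l * onorm R)))"
proof -
  interpret R: bounded_linear R by fact
  obtain F where F: "finite F" "orthonormal F" "span F = span E"
    "\<And>f g. f \<in> F \<Longrightarrow> g \<in> F \<Longrightarrow> f \<noteq> g \<Longrightarrow> f \<bullet> R g = 0"
    using finite_spectral_basis[OF E R(1,2)] by metis
  let ?K = "onorm R" and ?d = "1 - 2 * l * onorm R"
  have d: "0 < ?d" using l by simp
  have \<mu>: "0 \<le> l * (f \<bullet> R f)" "l * (f \<bullet> R f) \<le> l * ?K" "2 * l * (f \<bullet> R f) < 1" if "f \<in> F" for f
  proof -
    show "0 \<le> l * (f \<bullet> R f)" using R(3) l(1) by (simp add: positive_op_def)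
    show 1: "l * (f \<bullet> R f) \<le> l * ?K"
      using inner_le_onorm[OF R(1) orthonormal_norm[OF F(2) that]] l(1) by (rule mult_left_mono)
    show "2 * l * (f \<bullet> R f) < 1" using 1 l(2) by linarith
  qed
  have sq_le: "(f \<bullet> R f)\<^sup>2 \<le> (norm (R f))\<^sup>2" if "f \<in> F" for f
  proof -
    have "\<bar>f \<bullet> R f\<bar> \<le> norm (R f)"
      using Cauchy_Schwarz_ineq2[of f "R f"] orthonormal_norm[OF F(2) that] by simp
    then show ?thesis by (metis abs_ge_zero power2_abs power_mono)
  qed
  \<comment> \<open>The sum of \<open>|R f|^2\<close> is the trace of the compression of
    \<open>R \<circ> R\<close>, so it can be moved from \<open>F\<close> back to
    \<open>E\<close>.\<close>
  have "(\<Sum>f\<in>F. (f \<bullet> R f)\<^sup>2) \<le> (\<Sum>f\<in>F. (norm (R f))\<^sup>2)"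
    by (rule sum_mono) (rule sq_le)
  also have "\<dots> = (\<Sum>f\<in>F. f \<bullet> R (R f))"
    using R(2) by (simp add: self_adjoint_op_def power2_norm_eq_inner)
  also have "\<dots> = (\<Sum>e\<in>E. e \<bullet> R (R e))"
    by (rule trace_span_eq[OF F(1,2) E F(3)])
       (intro bounded_linear.linear bounded_linear_compose[OF R(1) R(1)])
  also have "\<dots> = (\<Sum>e\<in>E. (norm (R e))\<^sup>2)"
    using R(2) by (simp add: self_adjoint_op_def power2_norm_eq_inner)
  finally have hs: "(\<Sum>f\<in>F. (f \<bullet> R f)\<^sup>2) \<le> (\<Sum>e\<in>E. (norm (R e))\<^sup>2)" .
  have tr: "(\<Sum>f\<in>F. f \<bullet> R f) = (\<Sum>e\<in>E. e \<bullet> R e)"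
    by (rule trace_span_eq[OF F(1,2) E F(3) R.linear_axioms])
  have "(\<Prod>f\<in>F. 1 / sqrt (1 - 2 * l * (f \<bullet> R f)))
      \<le> (\<Prod>f\<in>F. exp (l * (f \<bullet> R f) + (l * (f \<bullet> R f))\<^sup>2 / ?d))"
  proof (rule prod_mono, intro conjI)
    fix f assume f: "f \<in> F"
    show "0 \<le> 1 / sqrt (1 - 2 * l * (f \<bullet> R f))" using \<mu>(3)[OF f] by simp
    show "1 / sqrt (1 - 2 * l * (f \<bullet> R f)) \<le> exp (l * (f \<bullet> R f) + (l * (f \<bullet> R f))\<^sup>2 / ?d)"
      using inverse_sqrt_le_exp[OF \<mu>(1,2)[OF f]] l(2) by (simp add: mult.assoc)
  qed
  also have "\<dots> = exp (\<Sum>f\<in>F. l * (f \<bullet> R f) + (l * (f \<bullet> R f))\<^sup>2 / ?d)"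
    by (simp add: exp_sum F(1))
  also have "(\<Sum>f\<in>F. l * (f \<bullet> R f) + (l * (f \<bullet> R f))\<^sup>2 / ?d)
      = l * (\<Sum>f\<in>F. f \<bullet> R f) + l\<^sup>2 * (\<Sum>f\<in>F. (f \<bullet> R f)\<^sup>2) / ?d"
    by (simp add: sum.distrib sum_distrib_left sum_divide_distrib power_mult_distrib)
  also have "\<dots> \<le> l * (\<Sum>e\<in>E. e \<bullet> R e) + l\<^sup>2 * (\<Sum>e\<in>E. (norm (R e))\<^sup>2) / ?d"
    unfolding tr using hs d by (intro add_left_mono divide_right_mono mult_left_mono) auto
  finally have prod_le: "(\<Prod>f\<in>F. 1 / sqrt (1 - 2 * l * (f \<bullet> R f)))
      \<le> exp (l * (\<Sum>e\<in>E. e \<bullet> R e) + l\<^sup>2 * (\<Sum>e\<in>E. (norm (R e))\<^sup>2) / ?d)" by simp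
  have "(\<Sum>e\<in>E. (e \<bullet> X \<omega>)\<^sup>2) = (\<Sum>f\<in>F. (f \<bullet> X \<omega>)\<^sup>2)" for \<omega>
    by (rule parseval_span_eq[OF E F(1,2) F(3)[symmetric]])
  then have "(\<integral>\<^sup>+\<omega>. ennreal (exp (l * (\<Sum>e\<in>E. (e \<bullet> X \<omega>)\<^sup>2))) \<partial>M)
      = (\<integral>\<^sup>+\<omega>. ennreal (exp (l * (\<Sum>f\<in>F. (f \<bullet> X \<omega>)\<^sup>2) + 0 \<bullet> X \<omega>)) \<partial>M)"
    by simp
  \<comment> \<open>The induction starts from the linear term \<open>u = 0\<close>, for which
    \<open>u \<bullet> R f = 0\<close> is immediate.\<close>
  also have "\<dots> \<le> ennreal (exp (1 / 2 * (0 \<bullet> R 0)) * (\<Prod>f\<in>F. 1 / sqrt (1 - 2 * l * (f \<bullet> R f))))"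
    by (rule subgaussian_exp_sum_squares[OF M X R(1,2) sub l(1) F(1,4) \<mu>(3)]) simp_all
  also have "\<dots> \<le> ennreal (exp (l * (\<Sum>e\<in>E. e \<bullet> R e) + l\<^sup>2 * (\<Sum>e\<in>E. (norm (R e))\<^sup>2) / ?d))"
    using prod_le by (intro ennreal_leI) simp
  finally show ?thesis .
qed

text \<open>The bounds for projections are uniform in \<open>n\<close>, because sums over
  \<open>F n\<close> are partial sums of the nonnegative series for the trace and the squared
  Hilbert-Schmidt norm. The integrands converge pointwise, so Fatou gives integrability together
  with the bound.\<close>

lemma subgaussian_exp_norm_square:
  fixes X :: "'b \<Rightarrow> 'a::{real_inner, banach, second_countable_topology}" and R :: "'a \<Rightarrow> 'a"
  assumes M: "prob_space M" and tc: "trace_class R" and R: "self_adjoint_op R" "positive_op R"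
    and X: "subgaussian M R X" and l: "0 \<le> l" "2 * l * onorm R < 1"
  shows "log_moment_le M (\<lambda>\<omega>. l * (norm (X \<omega>))\<^sup>2)
    (l * op_trace R + l\<^sup>2 * (hs_norm R)\<^sup>2 / (1 - 2 * l * onorm R))"
    (is "log_moment_le M _ ?c")
proof (rule log_moment_leI)
  have lin: "bounded_linear R" using tc by (simp add: trace_class_def)
  have Xm[measurable]: "X \<in> borel_measurable M"
    using X by (simp add: subgaussian_def borel_measurable_integrable)
  show "(\<lambda>\<omega>. l * (norm (X \<omega>))\<^sup>2) \<in> borel_measurable M" by measurable
  have sub: "(\<integral>\<^sup>+\<omega>. ennreal (exp (u \<bullet> X \<omega>)) \<partial>M) \<le> ennreal (exp (1 / 2 * (u \<bullet> R u)))" for u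
  proof -
    have lm: "log_moment_le M (\<lambda>\<omega>. u \<bullet> X \<omega>) (1 / 2 * (u \<bullet> R u))"
      using X by (simp add: subgaussian_def)
    then have "(\<integral>\<^sup>+\<omega>. ennreal (exp (u \<bullet> X \<omega>)) \<partial>M) = ennreal (\<integral>\<omega>. exp (u \<bullet> X \<omega>) \<partial>M)"
      by (simp add: log_moment_le_def nn_integral_eq_integral)
    then show ?thesis using log_moment_leD[OF lm] by (simp add: ennreal_leI)
  qed
  define B where "B = (some_onb :: 'a set)"
  have B: "orthonormal_basis B"
    unfolding B_def some_onb_def using orthonormal_basis_exists by (rule someI_ex)
  have oB: "orthonormal B" using B by (simp add: orthonormal_basis_def orthonormal_def)
  note summ = trace_class_summable[OF tc R B]
  have tr: "op_trace R = (\<Sum>\<^sub>\<infinity>e\<in>B. e \<bullet> R e)" by (simp add: op_trace_def B_def)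
  have hs: "(hs_norm R)\<^sup>2 = (\<Sum>\<^sub>\<infinity>e\<in>B. (norm (R e))\<^sup>2)"
    by (simp add: hs_norm_def B_def infsum_nonneg)
  have pos: "0 \<le> e \<bullet> R e" for e using R(2) by (simp add: positive_op_def)
  have "0 \<le> op_trace R" unfolding tr by (rule infsum_nonneg) (rule pos)
  then show "0 \<le> ?c" using l by (intro add_nonneg_nonneg divide_nonneg_nonneg) simp_all
  obtain F where F: "\<And>n. finite (F n)" "\<And>n. F n \<subseteq> B" "incseq F"
    "\<And>x. (\<lambda>n. proj (F n) x) \<longlonglongrightarrow> x"
    using orthonormal_basis_approx[OF B] by metis
  have oF: "orthonormal (F n)" for n by (rule orthonormal_subset[OF oB F(2)])
  let ?g = "\<lambda>n \<omega>. ennreal (exp (l * (\<Sum>e\<in>F n. (e \<bullet> X \<omega>)\<^sup>2)))"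
  have "?g n \<in> borel_measurable M" for n by measurable
  note fatou = nn_integral_liminf[of ?g, OF this]
  have "(\<lambda>n. ?g n \<omega>) \<longlonglongrightarrow> ennreal (exp (l * (norm (X \<omega>))\<^sup>2))" for \<omega>
    unfolding norm_proj[OF F(1) oF, symmetric] by (intro tendsto_intros F(4))
  then have lim: "liminf (\<lambda>n. ?g n \<omega>) = ennreal (exp (l * (norm (X \<omega>))\<^sup>2))" for \<omega>
    by (intro lim_imp_Liminf) simp_all
  have bound: "integral\<^sup>N M (?g n) \<le> ennreal (exp ?c)" for n
  proof -
    have "integral\<^sup>N M (?g n) \<le> ennreal (exp (l * (\<Sum>e\<in>F n. e \<bullet> R e) +
        l\<^sup>2 * (\<Sum>e\<in>F n. (norm (R e))\<^sup>2) / (1 - 2 * l * onorm R)))"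
      by (rule subgaussian_exp_projection[OF M Xm lin R sub l F(1) oF])
    also have "\<dots> \<le> ennreal (exp ?c)"
    proof -
      have "(\<Sum>e\<in>F n. e \<bullet> R e) \<le> op_trace R"
        unfolding tr by (rule finite_sum_le_infsum[OF summ(1) F(1,2) pos])
      moreover have "(\<Sum>e\<in>F n. (norm (R e))\<^sup>2) \<le> (hs_norm R)\<^sup>2"
        unfolding hs by (rule finite_sum_le_infsum[OF summ(2) F(1,2) zero_le_power2])
      ultimately show ?thesis using l
        by (intro ennreal_leI exp_le_cancel_iff[THEN iffD2] add_mono divide_right_mono mult_left_mono) simp_all
    qed
    finally show ?thesis .
  qed
  have "(\<integral>\<^sup>+\<omega>. ennreal (exp (l * (norm (X \<omega>))\<^sup>2)) \<partial>M) \<le> liminf (\<lambda>n. integral\<^sup>N M (?g n))"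
    using fatou by (simp only: lim)
  also have "\<dots> \<le> liminf (\<lambda>n::nat. ennreal (exp ?c))"
    by (rule Liminf_mono) (rule always_eventually, rule allI, rule bound)
  also have "\<dots> = ennreal (exp ?c)" by (rule Liminf_const) simp
  finally show "(\<integral>\<^sup>+\<omega>. ennreal (exp (l * (norm (X \<omega>))\<^sup>2)) \<partial>M) \<le> ennreal (exp ?c)" .
qed

theorem proposition2p2:
  fixes M :: "'b measure"
    and R :: "'a::{real_inner, banach, second_countable_topology} \<Rightarrow> 'a"
    and X :: "'b \<Rightarrow> 'a"
  assumes "prob_space M"
    and "trace_class R"
    and "self_adjoint_op R"
    and "positive_op R"
    and "subgaussian M R X"
  shows "(\<forall>l\<ge>0. 2 * l * onorm R < 1 \<longrightarrow>
            log_moment_le M (\<lambda>\<omega>. l * (norm (X \<omega>))\<^sup>2)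
              (l * op_trace R + l\<^sup>2 * (hs_norm R)\<^sup>2 / (1 - 2 * l * onorm R))) \<and>
         (\<forall>t\<ge>0. measure M {\<omega> \<in> space M.
              (norm (X \<omega>))\<^sup>2 > op_trace R + 2 * sqrt t * hs_norm R + 2 * t * onorm R} \<le> exp (- t))"
proof (intro conjI allI impI)
  fix l :: real assume "0 \<le> l" "2 * l * onorm R < 1"
  then show "log_moment_le M (\<lambda>\<omega>. l * (norm (X \<omega>))\<^sup>2)
      (l * op_trace R + l\<^sup>2 * (hs_norm R)\<^sup>2 / (1 - 2 * l * onorm R))"
    by (rule subgaussian_exp_norm_square[OF assms])
next
  fix t :: real assume t: "0 \<le> t"
  have X: "X \<in> borel_measurable M"
    using assms(5) by (simp add: subgaussian_def borel_measurable_integrable)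
  show "measure M {\<omega> \<in> space M.
      (norm (X \<omega>))\<^sup>2 > op_trace R + 2 * sqrt t * hs_norm R + 2 * t * onorm R} \<le> exp (- t)"
  proof (rule chernoff_subgamma[OF assms(1)])
    show "(\<lambda>\<omega>. (norm (X \<omega>))\<^sup>2) \<in> borel_measurable M" using X by measurable
    show "0 \<le> hs_norm R" by (simp add: hs_norm_def infsum_nonneg)
    show "0 \<le> onorm R" using assms(2) by (simp add: trace_class_def onorm_pos_le)
  qed (rule t, rule subgaussian_exp_norm_square[OF assms])
qed

end
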